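(* (i) Let $(\Lambda_j,\phi_j)=(\alpha_j^{-1}\Lambda_0,\alpha_j^{-1}\rho_j)$, $j=1,2$, be two parabolic two-dimensional $\mathbb Q$-lattices, with $\rho_j\in\overline{P(\hat{\mathbb Z})}$ and $\alpha_j\in P^+(\mathbb R)$. They are commensurable (as $\mathbb Q$-lattices) if and only if there exists $g\in P^+(\mathbb Q)$ such that $\rho_2=g\rho_1$ and $\alpha_2=g\alpha_1$. (ii) The space of parabolic $\mathbb Q$-lattices up to commensurability is canonically isomorphic to the quotient $$P^+(\mathbb Q)\backslash\big(\overline{P(\mathbb A_{\mathbb Q,f})}\times P^+(\mathbb R)\big),$$ where $P^+(\mathbb Q)$ acts diagonally by left multiplication (the class of the parabolic $\mathbb Q$-lattice $(\alpha^{-1}\Lambda_0,\alpha^{-1}\rho)$ corresponding to the class of $(\rho,\alpha)$).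
   Context: For a commutative ring $R$, $\overline{P(R)}=\left\{\begin{pmatrix} a&b\\0&1\end{pmatrix}: a,b\in R\right\}\subset M_2(R)$ and $P(R)$ is the group of those matrices with $a$ invertible; for a subring $R$ of $\mathbb R$, $P^+(R)$ is the subgroup of $P(R)$ with $a>0$. $\mathbb A_{\mathbb Q,f}$ denotes the finite adeles of $\mathbb Q$ and $\hat{\mathbb Z}\subset\mathbb A_{\mathbb Q,f}$ the profinite completion of $\mathbb Z$. $\mathbb Q$-lattices: a two-dimensional $\mathbb Q$-lattice is a pair $(\Lambda,\phi)$ with $\Lambda\subset\mathbb C$ a lattice and $\phi:\mathbb Q^2/\mathbb Z^2\to\mathbb Q\Lambda/\Lambda$ a homomorphism of abelian groups (arbitrary). Two $\mathbb Q$-lattices are commensurable if $\mathbb Q\Lambda_1=\mathbb Q\Lambda_2$ and $\phi_1=\phi_2$ modulo $\Lambda_1+\Lambda_2$; this is an equivalence relation. Use the $\mathbb R$-basis $e_1=1$, $e_2=-i$ of $\mathbb C$; $\alpha=\begin{pmatrix} a&b\\c&d\end{pmatrix}\in GL_2(\mathbb R)$ acts on $\mathbb C$ by $\alpha(xe_1+ye_2)=(ax+by)e_1+(cx+dy)e_2$. Put $\Lambda_0=\mathbb Ze_1+\mathbb Ze_2$. Using $\hat{\mathbb Z}=\mathrm{Hom}(\mathbb Q/\mathbb Z,\mathbb Q/\mathbb Z)$, a matrix $\rho=\begin{pmatrix} a&b\\c&d\end{pmatrix}\in M_2(\hat{\mathbb Z})$ defines $\rho:\mathbb Q^2/\mathbb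 Z^2\to\mathbb Q\Lambda_0/\Lambda_0$, $\rho(x,y)=(ax+by)e_1+(cx+dy)e_2$. For $\alpha\in GL_2^+(\mathbb R)$, $(\alpha^{-1}\Lambda_0,\alpha^{-1}\rho)$ is the $\mathbb Q$-lattice with $\Lambda=\alpha^{-1}\Lambda_0$ and $\phi=\alpha^{-1}\circ\rho$. A parabolic $\mathbb Q$-lattice is a two-dimensional $\mathbb Q$-lattice of the form $(\alpha^{-1}\Lambda_0,\alpha^{-1}\rho)$ with $\rho\in\overline{P(\hat{\mathbb Z})}$ and $\alpha\in P^+(\mathbb R)$. *)

theory Defs
  imports "HOL-Analysis.Analysis" "HOL-Algebra.Coset"
begin

section \<open>The profinite completion of the integers\<close>

text \<open>
  An element of the inverse limit of the rings $\mathbf{Z}/n\mathbf{Z}$ is the compatible family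
  of its canonical residues modulo the positive integers \<open>n\<close>.  The value at \<open>0\<close> is a dummy.
\<close>

typedef zhat = "{x :: nat \<Rightarrow> int. x 0 = 0 \<and> (\<forall>m n. 0 < n \<longrightarrow> m dvd n \<longrightarrow> x n mod int m = x m)}"
  morphisms residue Abs_zhat
  by (rule exI[of _ "\<lambda>_. 0"]) simp

setup_lifting type_definition_zhat

lemma residue_0 [simp]: "residue x 0 = 0"
  using residue[of x] by simp

lemma residue_mod_dvd: "0 < n \<Longrightarrow> m dvd n \<Longrightarrow> residue x n mod int m = residue x m"
  using residue[of x] by blast

lemma residue_mod [simp]: "residue x n mod int n = residue x n"
  by (cases "n = 0") (simp_all add: residue_mod_dvd)

lemma zhat_eqI: "(\<And>n. 0 < n \<Longrightarrow> residue x n = residue y n) \<Longrightarrow> x = y"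
  by (rule iffD1[OF residue_inject], rule ext) (metis gr0I residue_0)

lemma mod_mod_dvd: "m dvd n \<Longrightarrow> a mod int n mod int m = a mod int m"
  by (simp add: mod_mod_cancel)

instantiation zhat :: comm_ring_1
begin

lift_definition zero_zhat :: zhat is "\<lambda>n. 0"
  by simp

lift_definition one_zhat :: zhat is "\<lambda>n. if n = 0 then 0 else 1 mod int n"
proof (intro conjI allI impI)
  fix m n :: nat assume n: "0 < n" "m dvd n"
  then have "m \<noteq> 0"
    by auto
  with n show "(if n = 0 then 0 else 1 mod int n) mod int m = (if m = 0 then 0 else 1 mod int m)"
    by (simp only: mod_mod_dvd[OF n(2)] if_False neq0_conv[THEN iffD2])
qed simp

lift_definition plus_zhat :: "zhat \<Rightarrow> zhat \<Rightarrow> zhat" is "\<lambda>x y n. (x n + y n) mod int n"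
proof (intro conjI allI impI)
  fix x y :: "nat \<Rightarrow> int" and m n :: nat
  assume a: "x 0 = 0 \<and> (\<forall>m n. 0 < n \<longrightarrow> m dvd n \<longrightarrow> x n mod int m = x m)" "y 0 = 0 \<and> (\<forall>m n. 0 < n \<longrightarrow> m dvd n \<longrightarrow> y n mod int m = y m)"
  show "(x 0 + y 0) mod int 0 = 0"
    using a by simp
  assume n: "0 < n" "m dvd n"
  have "x n mod int m = x m" "y n mod int m = y m"
    using a n by blast+
  then show "(x n + y n) mod int n mod int m = (x m + y m) mod int m"
    unfolding mod_mod_dvd[OF n(2)] by (metis mod_add_eq mod_mod_trivial)
qed

lift_definition times_zhat :: "zhat \<Rightarrow> zhat \<Rightarrow> zhat" is "\<lambda>x y n. (x n * y n) mod int n"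
proof (intro conjI allI impI)
  fix x y :: "nat \<Rightarrow> int" and m n :: nat
  assume a: "x 0 = 0 \<and> (\<forall>m n. 0 < n \<longrightarrow> m dvd n \<longrightarrow> x n mod int m = x m)" "y 0 = 0 \<and> (\<forall>m n. 0 < n \<longrightarrow> m dvd n \<longrightarrow> y n mod int m = y m)"
  show "(x 0 * y 0) mod int 0 = 0"
    using a by simp
  assume n: "0 < n" "m dvd n"
  have "x n mod int m = x m" "y n mod int m = y m"
    using a n by blast+
  then show "(x n * y n) mod int n mod int m = (x m * y m) mod int m"
    unfolding mod_mod_dvd[OF n(2)] by (metis mod_mult_eq mod_mod_trivial)
qed

lift_definition uminus_zhat :: "zhat \<Rightarrow> zhat" is "\<lambda>x n. (- x n) mod int n"
proof (intro conjI allI impI)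
  fix x :: "nat \<Rightarrow> int" and m n :: nat
  assume a: "x 0 = 0 \<and> (\<forall>m n. 0 < n \<longrightarrow> m dvd n \<longrightarrow> x n mod int m = x m)"
  show "(- x 0) mod int 0 = 0"
    using a by simp
  assume n: "0 < n" "m dvd n"
  have "x n mod int m = x m"
    using a n by blast+
  then show "(- x n) mod int n mod int m = (- x m) mod int m"
    unfolding mod_mod_dvd[OF n(2)] by (metis mod_minus_eq mod_mod_trivial)
qed

definition minus_zhat :: "zhat \<Rightarrow> zhat \<Rightarrow> zhat" where "minus_zhat x y = x + - y"

instance
proof
  fix a b c :: zhat
  note r = plus_zhat.rep_eq times_zhat.rep_eq one_zhat.rep_eq zero_zhat.rep_eq uminus_zhat.rep_eq
  show "a * b * c = a * (b * c)"
    by (rule zhat_eqI) (simp add: r mod_mult_left_eq mod_mult_right_eq mult.assoc)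
  show "a * b = b * a"
    by (rule zhat_eqI) (simp add: r mult.commute)
  show "1 * a = a"
    by (rule zhat_eqI) (simp add: r mod_mult_left_eq)
  show "a + b + c = a + (b + c)"
    by (rule zhat_eqI) (simp add: r mod_add_left_eq mod_add_right_eq add.assoc)
  show "a + b = b + a"
    by (rule zhat_eqI) (simp add: r add.commute)
  show "0 + a = a"
    by (rule zhat_eqI) (simp add: r)
  show "- a + a = 0"
    by (rule zhat_eqI) (simp add: r mod_add_left_eq)
  show "a - b = a + - b"
    by (simp add: minus_zhat_def)
  show "(a + b) * c = a * c + b * c"
    by (rule zhat_eqI) (simp add: r mod_mult_left_eq mod_add_eq distrib_right)
  have "residue 0 2 \<noteq> residue 1 2"
    by (simp add: r)
  then show "(0::zhat) \<noteq> 1"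
    by metis
qed

end

lifting_forget zhat.lifting

lemma residue_of_nat: "0 < n \<Longrightarrow> residue (of_nat k) n = int k mod int n"
proof (induction k)
  case 0
  then show ?case by (simp add: zero_zhat.rep_eq)
next
  case (Suc k)
  then show ?case
    by (simp add: plus_zhat.rep_eq one_zhat.rep_eq mod_add_eq)
qed

lemma zhat_torsion_free:
  fixes x :: zhat
  assumes "0 < k" "of_nat k * x = 0"
  shows "x = 0"
proof (rule zhat_eqI)
  fix n :: nat assume n: "0 < n"
  have kn: "0 < k * n"
    using n assms by simp
  have "(int k * residue x (k * n)) mod (int k * int n) = residue (of_nat k * x) (k * n)"
    using residue_of_nat[OF kn, of k]
    by (simp add: times_zhat.rep_eq) (simp add: mod_mult_left_eq)
  also have "\<dots> = 0"
    using assms by (simp add: zero_zhat.rep_eq)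
  finally have "int n dvd residue x (k * n)"
    using assms by (simp add: mod_eq_0_iff_dvd)
  then have "residue x (k * n) mod int n = 0"
    by simp
  then have "residue x n = 0"
    using residue_mod_dvd[OF kn, of n x] by simp
  then show "residue x n = residue 0 n"
    by (simp add: zero_zhat.rep_eq)
qed

lemma zhat_cancel:
  fixes x y :: zhat
  assumes "0 < k" "of_nat k * x = of_nat k * y"
  shows "x = y"
  using zhat_torsion_free[of k "x - y"] assms by (simp add: right_diff_distrib)

text \<open>The profinite topology: the subgroups of elements with vanishing \<open>n\<close>-th residue are a
  basis of neighbourhoods of \<open>0\<close>.\<close>

instantiation zhat :: topological_space
begin

definition open_zhat :: "zhat set \<Rightarrow> bool" where
  "open_zhat U \<longleftrightarrow> (\<forall>x\<in>U. \<exists>n>0. \<forall>y. residue y n = residue x n \<longrightarrow> y \<in> U)"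

instance
proof
  show "open (UNIV :: zhat set)"
    by (auto simp: open_zhat_def)
next
  fix S T :: "zhat set" assume ST: "open S" "open T"
  show "open (S \<inter> T)"
    unfolding open_zhat_def
  proof
    fix x assume x: "x \<in> S \<inter> T"
    obtain m where m: "m > 0" "\<And>y. residue y m = residue x m \<Longrightarrow> y \<in> S"
      using ST(1) x unfolding open_zhat_def by blast
    obtain n where n: "n > 0" "\<And>y. residue y n = residue x n \<Longrightarrow> y \<in> T"
      using ST(2) x unfolding open_zhat_def by blast
    have mn: "0 < m * n"
      using m n by simp
    have "y \<in> S \<inter> T" if y: "residue y (m * n) = residue x (m * n)" for y
    proof
      have "residue y m = residue x m"
        unfolding residue_mod_dvd[OF mn dvd_triv_left, symmetric] y ..
      then show "y \<in> S" by (rule m)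
      have "residue y n = residue x n"
        unfolding residue_mod_dvd[OF mn dvd_triv_right, symmetric] y ..
      then show "y \<in> T" by (rule n)
    qed
    with mn show "\<exists>k>0. \<forall>y. residue y k = residue x k \<longrightarrow> y \<in> S \<inter> T"
      by blast
  qed
next
  fix K :: "zhat set set" assume K: "\<forall>S\<in>K. open S"
  show "open (\<Union>K)"
    unfolding open_zhat_def
  proof
    fix x assume "x \<in> \<Union>K"
    then obtain S where S: "S \<in> K" "x \<in> S" by blast
    then obtain n where "n > 0" "\<forall>y. residue y n = residue x n \<longrightarrow> y \<in> S"
      using K unfolding open_zhat_def by blast
    with S show "\<exists>n>0. \<forall>y. residue y n = residue x n \<longrightarrow> y \<in> \<Union>K"
      by blast
  qed
qed

end

section \<open>The finite adeles of the rationals\<close>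

text \<open>
  The ring of finite adeles is $\hat{\mathbf{Z}} \otimes \mathbf{Q}$, the ring of fractions of
  $\hat{\mathbf{Z}}$ with positive integers as denominators.  The ring $\hat{\mathbf{Z}}$ has
  zero divisors, so this is not an instance of the field of fractions of a domain; equality of
  fractions needs no extra factor since $\hat{\mathbf{Z}}$ is torsion-free.
\<close>

definition adele_rel :: "zhat \<times> nat \<Rightarrow> zhat \<times> nat \<Rightarrow> bool" where
  "adele_rel p q \<longleftrightarrow> 0 < snd p \<and> 0 < snd q \<and> of_nat (snd q) * fst p = of_nat (snd p) * fst q"

lemma part_equivp_adele_rel: "part_equivp adele_rel"
proof (rule part_equivpI)
  show "\<exists>x. adele_rel x x"
    by (rule exI[of _ "(0, 1)"]) (simp add: adele_rel_def)
  show "symp adele_rel"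
    by (auto intro!: sympI simp: adele_rel_def)
  show "transp adele_rel"
  proof (rule transpI)
    fix p q r assume a: "adele_rel p q" "adele_rel q r"
    have pq: "of_nat (snd q) * fst p = of_nat (snd p) * fst q"
      and qr: "of_nat (snd r) * fst q = of_nat (snd q) * fst r"
      using a by (auto simp: adele_rel_def)
    have "of_nat (snd q) * (of_nat (snd r) * fst p) = of_nat (snd r) * (of_nat (snd q) * fst p)"
      by (rule mult.left_commute)
    also have "\<dots> = of_nat (snd p) * (of_nat (snd r) * fst q)"
      unfolding pq by (rule mult.left_commute)
    also have "\<dots> = of_nat (snd q) * (of_nat (snd p) * fst r)"
      unfolding qr by (rule mult.left_commute)
    finally show "adele_rel p r"
      using a zhat_cancel[of "snd q"] by (auto simp: adele_rel_def)
  qed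
qed

quotient_type finite_adele = "zhat \<times> nat" / partial: adele_rel
  by (rule part_equivp_adele_rel)

lift_definition adele_frac :: "zhat \<Rightarrow> nat \<Rightarrow> finite_adele"
  is "\<lambda>x n. if n = 0 then (0, 1) else (x, n)"
  by (simp add: adele_rel_def)

lemma adele_frac_eq_iff:
  "0 < m \<Longrightarrow> 0 < n \<Longrightarrow> adele_frac x m = adele_frac y n \<longleftrightarrow> of_nat n * x = of_nat m * y"
  by transfer (simp add: adele_rel_def)

lemma adele_frac_cases:
  obtains x n where "0 < n" "a = adele_frac x n"
proof -
  have "\<exists>x n. 0 < n \<and> a = adele_frac x n"
  proof transfer
    fix a assume "adele_rel a a"
    then show "\<exists>x n. 0 < n \<and> adele_rel a (if n = 0 then (0, 1) else (x, n))"
      by (intro exI[of _ "fst a"] exI[of _ "snd a"]) (auto simp: adele_rel_def)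
  qed
  then show ?thesis using that by blast
qed

instantiation finite_adele :: comm_ring_1
begin

lift_definition zero_finite_adele :: finite_adele is "(0, 1)"
  by (simp add: adele_rel_def)

lift_definition one_finite_adele :: finite_adele is "(1, 1)"
  by (simp add: adele_rel_def)

lift_definition plus_finite_adele :: "finite_adele \<Rightarrow> finite_adele \<Rightarrow> finite_adele"
  is "\<lambda>p q. (of_nat (snd q) * fst p + of_nat (snd p) * fst q, snd p * snd q)"
proof -
  fix p p' q q' assume a: "adele_rel p p'" "adele_rel q q'"
  have p: "of_nat (snd p') * fst p = of_nat (snd p) * fst p'"
    and q: "of_nat (snd q') * fst q = of_nat (snd q) * fst q'"
    using a by (auto simp: adele_rel_def)
  have "of_nat (snd p' * snd q') * (of_nat (snd q) * fst p + of_nat (snd p) * fst q)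
      = of_nat (snd q') * of_nat (snd q) * (of_nat (snd p') * fst p)
        + of_nat (snd p') * of_nat (snd p) * (of_nat (snd q') * fst q)"
    by (simp add: algebra_simps)
  also have "\<dots> = of_nat (snd p * snd q) * (of_nat (snd q') * fst p' + of_nat (snd p') * fst q')"
    unfolding p q by (simp add: algebra_simps)
  finally show "adele_rel (of_nat (snd q) * fst p + of_nat (snd p) * fst q, snd p * snd q)
      (of_nat (snd q') * fst p' + of_nat (snd p') * fst q', snd p' * snd q')"
    using a by (simp add: adele_rel_def)
qed

lift_definition uminus_finite_adele :: "finite_adele \<Rightarrow> finite_adele"
  is "\<lambda>p. (- fst p, snd p)"
  by (simp add: adele_rel_def)

definition minus_finite_adele :: "finite_adele \<Rightarrow> finite_adele \<Rightarrow> finite_adele" where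
  "minus_finite_adele x y = x + - y"

lift_definition times_finite_adele :: "finite_adele \<Rightarrow> finite_adele \<Rightarrow> finite_adele"
  is "\<lambda>p q. (fst p * fst q, snd p * snd q)"
proof -
  fix p p' q q' assume a: "adele_rel p p'" "adele_rel q q'"
  have p: "of_nat (snd p') * fst p = of_nat (snd p) * fst p'"
    and q: "of_nat (snd q') * fst q = of_nat (snd q) * fst q'"
    using a by (auto simp: adele_rel_def)
  have "of_nat (snd p' * snd q') * (fst p * fst q)
      = (of_nat (snd p') * fst p) * (of_nat (snd q') * fst q)"
    by (simp add: algebra_simps)
  also have "\<dots> = of_nat (snd p * snd q) * (fst p' * fst q')"
    unfolding p q by (simp add: algebra_simps)
  finally show "adele_rel (fst p * fst q, snd p * snd q) (fst p' * fst q', snd p' * snd q')"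
    using a by (simp add: adele_rel_def)
qed

instance
proof
  fix a b c :: finite_adele
  show "a * b * c = a * (b * c)"
    by transfer (simp add: adele_rel_def algebra_simps)
  show "a * b = b * a"
    by transfer (simp add: adele_rel_def algebra_simps)
  show "1 * a = a"
    by transfer (simp add: adele_rel_def)
  show "a + b + c = a + (b + c)"
    by transfer (simp add: adele_rel_def algebra_simps)
  show "a + b = b + a"
    by transfer (simp add: adele_rel_def algebra_simps)
  show "0 + a = a"
    by transfer (simp add: adele_rel_def)
  show "- a + a = 0"
    by transfer (simp add: adele_rel_def)
  show "a - b = a + - b"
    by (simp add: minus_finite_adele_def)
  show "(a + b) * c = a * c + b * c"
    by transfer (simp add: adele_rel_def algebra_simps)
  show "(0::finite_adele) \<noteq> 1"
    by transfer (simp add: adele_rel_def)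
qed

end

lemma adele_frac_add:
  "0 < m \<Longrightarrow> 0 < n \<Longrightarrow>
    adele_frac x m + adele_frac y n = adele_frac (of_nat n * x + of_nat m * y) (m * n)"
  by transfer (simp add: adele_rel_def)

lemma adele_frac_mult:
  "0 < m \<Longrightarrow> 0 < n \<Longrightarrow> adele_frac x m * adele_frac y n = adele_frac (x * y) (m * n)"
  by transfer (simp add: adele_rel_def)

definition adele_of_zhat :: "zhat \<Rightarrow> finite_adele" where
  "adele_of_zhat x = adele_frac x 1"

lemma inj_adele_of_zhat: "inj adele_of_zhat"
  by (rule injI) (simp add: adele_of_zhat_def adele_frac_eq_iff)

definition adele_of_rat :: "rat \<Rightarrow> finite_adele" where
  "adele_of_rat q = adele_frac (of_int (fst (quotient_of q))) (nat (snd (quotient_of q)))"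

text \<open>The subgroups $n\hat{\mathbf{Z}}$ are a basis of neighbourhoods of \<open>0\<close>, so that
  $\hat{\mathbf{Z}}$ with its profinite topology is an open subring.\<close>

instantiation finite_adele :: topological_space
begin

definition open_finite_adele :: "finite_adele set \<Rightarrow> bool" where
  "open_finite_adele U \<longleftrightarrow> (\<forall>x\<in>U. \<exists>n>0. \<forall>z. x + adele_of_zhat (of_nat n * z) \<in> U)"

instance
proof
  show "open (UNIV :: finite_adele set)"
    by (auto simp: open_finite_adele_def)
next
  fix S T :: "finite_adele set" assume ST: "open S" "open T"
  show "open (S \<inter> T)"
    unfolding open_finite_adele_def
  proof
    fix x assume x: "x \<in> S \<inter> T"
    obtain m where m: "m > 0" "\<And>z. x + adele_of_zhat (of_nat m * z) \<in> S"
      using ST(1) x unfolding open_finite_adele_def by blast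
    obtain n where n: "n > 0" "\<And>z. x + adele_of_zhat (of_nat n * z) \<in> T"
      using ST(2) x unfolding open_finite_adele_def by blast
    have mn: "0 < m * n"
      using m n by simp
    have "x + adele_of_zhat (of_nat (m * n) * z) \<in> S \<inter> T" for z
      using m(2)[of "of_nat n * z"] n(2)[of "of_nat m * z"]
      by (simp add: mult.assoc mult.left_commute)
    with mn show "\<exists>k>0. \<forall>z. x + adele_of_zhat (of_nat k * z) \<in> S \<inter> T"
      by blast
  qed
next
  fix K :: "finite_adele set set" assume K: "\<forall>S\<in>K. open S"
  show "open (\<Union>K)"
    unfolding open_finite_adele_def
  proof
    fix x assume "x \<in> \<Union>K"
    then obtain S where S: "S \<in> K" "x \<in> S" by blast
    then obtain n where "n > 0" "\<forall>z. x + adele_of_zhat (of_nat n * z) \<in> S"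
      using K unfolding open_finite_adele_def by blast
    with S show "\<exists>n>0. \<forall>z. x + adele_of_zhat (of_nat n * z) \<in> \<Union>K"
      by blast
  qed
qed

end

section \<open>The parabolic matrices\<close>

definition parabolic_matrix :: "'a::comm_ring_1 \<Rightarrow> 'a \<Rightarrow> 'a^2^2" where
  "parabolic_matrix a b = vector [vector [a, b], vector [0, 1]]"

definition P_bar :: "('a::comm_ring_1^2^2) set" where
  "P_bar = {parabolic_matrix a b | a b. True}"

definition P_plus :: "('a::linordered_idom^2^2) set" where
  "P_plus = {parabolic_matrix a b | a b. a dvd 1 \<and> a > 0}"

section \<open>Two-dimensional Q-lattices\<close>

definition additive_group :: "'a::ab_group_add set \<Rightarrow> 'a monoid" where
  "additive_group S = \<lparr>carrier = S, monoid.mult = (+), one = 0\<rparr>"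

definition complex_lattice :: "complex set \<Rightarrow> bool" where
  "complex_lattice L \<longleftrightarrow>
    (\<exists>u v. u \<noteq> v \<and> independent {u, v} \<and> L = {of_int m * u + of_int n * v | m n. True})"

definition rational_span :: "complex set \<Rightarrow> complex set" where
  "rational_span L = {of_rat q * l | q l. l \<in> L}"

definition Q2_mod_Z2 :: "(rat^2) set monoid" where
  "Q2_mod_Z2 = additive_group UNIV Mod {v. \<forall>i. v $ i \<in> \<int>}"

definition span_mod_lattice :: "complex set \<Rightarrow> complex set monoid" where
  "span_mod_lattice L = additive_group (rational_span L) Mod L"

text \<open>The homomorphism is required to be \<open>undefined\<close> off its domain, so that equality of pairs
  is equality of \<open>\<rat>\<close>-lattices.\<close>

type_synonym lattice_pair = "complex set \<times> ((rat^2) set \<Rightarrow> complex set)"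

definition Q_lattice :: "lattice_pair \<Rightarrow> bool" where
  "Q_lattice = (\<lambda>(L, \<phi>). complex_lattice L \<and>
     \<phi> \<in> hom Q2_mod_Z2 (span_mod_lattice L) \<inter> extensional (carrier Q2_mod_Z2))"

text \<open>The image of a coset \<open>C\<close> of \<open>L1\<close> modulo \<open>L1 + L2\<close> is the set sum \<open>C + (L1 + L2)\<close>.\<close>

definition commensurable :: "lattice_pair \<Rightarrow> lattice_pair \<Rightarrow> bool" where
  "commensurable = (\<lambda>(L1, \<phi>1) (L2, \<phi>2). rational_span L1 = rational_span L2 \<and>
     (\<forall>t \<in> carrier Q2_mod_Z2. \<phi>1 t + (L1 + L2) = \<phi>2 t + (L1 + L2)))"

section \<open>The Q-lattice attached to a pair of matrices\<close>

definition e1 :: complex where "e1 = 1"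
definition e2 :: complex where "e2 = - \<i>"

text \<open>The coordinates of \<open>z\<close> in the basis \<open>e1\<close>, \<open>e2\<close> are \<open>Re z\<close> and \<open>- Im z\<close>.\<close>

definition mat_act :: "real^2^2 \<Rightarrow> complex \<Rightarrow> complex" where
  "mat_act \<alpha> z = (let w = \<alpha> *v vector [Re z, - Im z] in
     complex_of_real (w $ 1) * e1 + complex_of_real (w $ 2) * e2)"

definition Lambda0 :: "complex set" where
  "Lambda0 = {of_int m * e1 + of_int n * e2 | m n. True}"

text \<open>A representative of the image of the class of \<open>q\<close> under the endomorphism of
  \<open>\<rat>/\<int>\<close> given by \<open>x\<close>: on \<open>p/n\<close> the profinite integer \<open>x\<close> acts as its residue modulo \<open>n\<close>.\<close>

definition zhat_act :: "zhat \<Rightarrow> rat \<Rightarrow> rat" where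
  "zhat_act x q = of_int (residue x (nat (snd (quotient_of q)))) * q"

definition rho_rep :: "zhat^2^2 \<Rightarrow> rat^2 \<Rightarrow> complex" where
  "rho_rep \<rho> v = of_rat (zhat_act (\<rho> $ 1 $ 1) (v $ 1) + zhat_act (\<rho> $ 1 $ 2) (v $ 2)) * e1
     + of_rat (zhat_act (\<rho> $ 2 $ 1) (v $ 1) + zhat_act (\<rho> $ 2 $ 2) (v $ 2)) * e2"

text \<open>The union is over the representatives \<open>v\<close> of \<open>t\<close>, which all give the same coset of
  \<open>Lambda0\<close>, see \<open>rho_map_coset\<close> below.\<close>

definition rho_map :: "zhat^2^2 \<Rightarrow> (rat^2) set \<Rightarrow> complex set" where
  "rho_map \<rho> t = (\<Union>v\<in>t. {rho_rep \<rho> v} + Lambda0)"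

definition Q_lattice_of :: "zhat^2^2 \<Rightarrow> real^2^2 \<Rightarrow> lattice_pair" where
  "Q_lattice_of \<rho> \<alpha> = (mat_act (matrix_inv \<alpha>) ` Lambda0,
     restrict (\<lambda>t. mat_act (matrix_inv \<alpha>) ` rho_map \<rho> t) (carrier Q2_mod_Z2))"

lemma zhat_act_denominator:
  assumes "0 < n" "of_nat n * q \<in> \<int>"
  shows "zhat_act x q - of_int (residue x n) * q \<in> \<int>"
proof -
  obtain p d where pd: "quotient_of q = (p, d)" by fastforce
  have d: "0 < d" using quotient_of_denom_pos[OF pd] .
  have q: "q = of_int p / of_int d" using quotient_of_div[OF pd] .
  obtain a where a: "of_nat n * q = of_int a" using assms(2) by (rule Ints_cases)
  have "(of_int (int n * p) :: rat) = of_int (a * d)"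
    using a d unfolding q by (simp add: field_simps)
  then have "int n * p = a * d" unfolding of_int_eq_iff .
  then have "d dvd int n * p" by simp
  moreover have "coprime d p" using quotient_of_coprime[OF pd] by (simp add: coprime_commute)
  ultimately have "d dvd int n" by (simp add: coprime_dvd_mult_left_iff)
  then have dn: "nat d dvd n" using d by (simp add: nat_dvd_iff)
  have "residue x n mod int (nat d) = residue x (nat d) mod int (nat d)"
    unfolding residue_mod_dvd[OF assms(1) dn] residue_mod ..
  then have "d dvd residue x (nat d) - residue x n"
    using d by (simp add: mod_eq_dvd_iff dvd_diff_commute)
  then obtain k where k: "residue x (nat d) - residue x n = d * k" by (rule dvdE)
  have "zhat_act x q - of_int (residue x n) * q = of_int (residue x (nat d) - residue x n) * q"
    by (simp add: zhat_act_def pd left_diff_distrib)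
  also have "\<dots> = of_int (k * p)"
    unfolding k q using d by simp
  finally show ?thesis by simp
qed

lemma rat_denominator: "\<exists>n>0. of_nat n * r \<in> \<int>" for r :: rat
proof -
  obtain a d where ad: "quotient_of r = (a, d)" by fastforce
  have d: "0 < d" using quotient_of_denom_pos[OF ad] .
  then have "of_nat (nat d) * r = of_int a"
    using quotient_of_div[OF ad] by simp
  then show ?thesis using d by (intro exI[of _ "nat d"]) simp
qed

lemma zhat_act_add: "zhat_act x (p + q) - (zhat_act x p + zhat_act x q) \<in> \<int>"
proof -
  obtain m where m: "0 < m" "of_nat m * p \<in> \<int>" using rat_denominator by blast
  obtain n where n: "0 < n" "of_nat n * q \<in> \<int>" using rat_denominator by blast
  have N: "0 < m * n" using m n by simp
  have p: "of_nat (m * n) * p \<in> \<int>"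
    using Ints_mult[OF Ints_of_nat[of n] m(2)] by (simp add: mult.assoc mult.left_commute)
  have q: "of_nat (m * n) * q \<in> \<int>"
    using Ints_mult[OF Ints_of_nat[of m] n(2)] by (simp add: mult.assoc mult.left_commute)
  have pq: "of_nat (m * n) * (p + q) \<in> \<int>"
    using Ints_add[OF p q] by (simp only: distrib_left)
  show ?thesis
    using Ints_diff[OF zhat_act_denominator[OF N pq, of x]
        Ints_add[OF zhat_act_denominator[OF N p, of x] zhat_act_denominator[OF N q, of x]]]
    by (simp add: algebra_simps)
qed

lemma zhat_act_Ints: "q \<in> \<int> \<Longrightarrow> zhat_act x q \<in> \<int>"
  using Ints_add[OF zhat_act_denominator[of 1 q x] Ints_mult[OF Ints_of_int, of q "residue x 1"]] by simp

lemma Z2_coset: "{v::rat^2. \<forall>i. v $ i \<in> \<int>} #>\<^bsub>additive_group UNIV\<^esub> a = {w. \<forall>i. (w - a) $ i \<in> \<int>}"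
proof -
  have "w \<in> (\<lambda>h. h + a) ` {v. \<forall>i. v $ i \<in> \<int>}" if "\<forall>i. (w - a) $ i \<in> \<int>" for w
    using that by (intro image_eqI[of _ _ "w - a"]) auto
  then show ?thesis
    unfolding r_coset_def additive_group_def by fastforce
qed

lemma Lambda0I: "p \<in> \<int> \<Longrightarrow> q \<in> \<int> \<Longrightarrow> of_rat p * e1 + of_rat q * e2 \<in> Lambda0"
  unfolding Lambda0_def by (elim Ints_cases) (auto intro!: exI)

lemma Lambda0_add: "x \<in> Lambda0 \<Longrightarrow> y \<in> Lambda0 \<Longrightarrow> x + y \<in> Lambda0"
proof -
  assume "x \<in> Lambda0" "y \<in> Lambda0"
  then obtain a b c d where "x = of_int a * e1 + of_int b * e2" "y = of_int c * e1 + of_int d * e2"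
    unfolding Lambda0_def by blast
  then have "x + y = of_int (a+c) * e1 + of_int (b+d) * e2" by (simp add: algebra_simps)
  then show ?thesis unfolding Lambda0_def by blast
qed

lemma Lambda0_minus: "x \<in> Lambda0 \<Longrightarrow> - x \<in> Lambda0"
proof -
  assume "x \<in> Lambda0"
  then obtain a b  where "x = of_int a * e1 + of_int b * e2" 
    unfolding Lambda0_def by blast
  then have "-x = of_int (-a) * e1 + of_int (-b) * e2" by (simp add: algebra_simps)
  then show ?thesis unfolding Lambda0_def by blast
qed

lemma rho_rep_add: "rho_rep \<rho> (v + w) - (rho_rep \<rho> v + rho_rep \<rho> w) \<in> Lambda0"
proof -
  let ?d = "\<lambda>(i::2) (j::2). zhat_act (\<rho> $ i $ j) ((v+w) $ j) - (zhat_act (\<rho> $ i $ j) (v $ j) + zhat_act (\<rho> $ i $ j) (w $ j))"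
  have d: "?d i j \<in> \<int>" for i j using zhat_act_add by simp
  have "of_rat (?d 1 1 + ?d 1 2) * e1 + of_rat (?d 2 1 + ?d 2 2) * e2 \<in> Lambda0"
    by (intro Lambda0I Ints_add d)
  also have "of_rat (?d 1 1 + ?d 1 2) * e1 + of_rat (?d 2 1 + ?d 2 2) * e2 = rho_rep \<rho> (v + w) - (rho_rep \<rho> v + rho_rep \<rho> w)"
    unfolding rho_rep_def by (simp add: of_rat_add of_rat_diff algebra_simps)
  finally show ?thesis .
qed

lemma rho_rep_int: "\<forall>i. v $ i \<in> \<int> \<Longrightarrow> rho_rep \<rho> v \<in> Lambda0"
  unfolding rho_rep_def by (intro Lambda0I Ints_add zhat_act_Ints) auto

lemma rho_map_coset: "rho_map \<rho> {w. \<forall>i. (w - a) $ i \<in> \<int>} = {z. z - rho_rep \<rho> a \<in> Lambda0}"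
proof -
  have *: "rho_rep \<rho> w - rho_rep \<rho> a \<in> Lambda0" if "\<forall>i. (w - a) $ i \<in> \<int>" for w
    using Lambda0_add[OF rho_rep_add[of \<rho> "w - a" a] rho_rep_int[OF that, of \<rho>]] by simp
  have "rho_map \<rho> {w. \<forall>i. (w - a) $ i \<in> \<int>} = (\<Union>w\<in>{w. \<forall>i. (w - a) $ i \<in> \<int>}. {rho_rep \<rho> w} + Lambda0)"
    by (simp add: rho_map_def)
  also have "\<dots> = {z. z - rho_rep \<rho> a \<in> Lambda0}"
  proof safe
    fix w z assume w: "\<forall>i. (w - a) $ i \<in> \<int>" and "z \<in> {rho_rep \<rho> w} + Lambda0"
    then obtain l where "l \<in> Lambda0" "z = rho_rep \<rho> w + l" by (auto simp: set_plus_def)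
    then show "z - rho_rep \<rho> a \<in> Lambda0" using Lambda0_add[OF *[OF w], of l] by (simp add: algebra_simps)
  next
    fix z assume "z - rho_rep \<rho> a \<in> Lambda0"
    then have "z \<in> {rho_rep \<rho> a} + Lambda0"
      unfolding set_plus_def by (auto intro!: bexI[of _ "z - rho_rep \<rho> a"])
    then show "z \<in> (\<Union>w\<in>{w. \<forall>i. (w - a) $ i \<in> \<int>}. {rho_rep \<rho> w} + Lambda0)"
      by (intro UN_I[of a]) auto
  qed
  finally show ?thesis .
qed

lemma mat_act_add: "mat_act M (x + y) = mat_act M x + mat_act M y"
  by (simp add: mat_act_def Let_def matrix_vector_mult_def sum_2 algebra_simps)

lemma mat_act_scale: "mat_act M (complex_of_real r * x) = complex_of_real r * mat_act M x"
  by (simp add: mat_act_def Let_def matrix_vector_mult_def sum_2 algebra_simps)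

lemma mat_act_mult: "mat_act M (mat_act N x) = mat_act (M ** N) x"
  by (simp add: mat_act_def Let_def matrix_vector_mult_def matrix_matrix_mult_def sum_2 algebra_simps e1_def e2_def)

lemma mat_act_one: "mat_act (mat 1) x = x"
  by (simp add: mat_act_def Let_def e1_def e2_def complex_eq_iff)


lemma Q_lattice_Q_lattice_of:
  assumes "invertible \<alpha>"
  shows "Q_lattice (Q_lattice_of \<rho> \<alpha>)"
proof -
  define M where "M = matrix_inv \<alpha>"
  define L where "L = mat_act M ` Lambda0"
  have M: "M ** \<alpha> = mat 1" "\<alpha> ** M = mat 1"
    using someI_ex[OF assms[unfolded invertible_def]] unfolding M_def matrix_inv_def by auto
  have inv: "mat_act \<alpha> (mat_act M x) = x" "mat_act M (mat_act \<alpha> x) = x" for x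
    by (simp_all add: mat_act_mult M mat_act_one)
  have zero: "mat_act N 0 = 0" for N
    using mat_act_scale[of N 0 0] by simp
  have diff: "mat_act N (x - y) = mat_act N x - mat_act N y" for N x y
    using mat_act_add[of N "x - y" y] by simp
  have inL: "mat_act M x \<in> L \<longleftrightarrow> x \<in> Lambda0" for x
    unfolding L_def using inv by (metis imageE imageI)
  have img: "mat_act M ` {z. z - x \<in> Lambda0} = {y. y - mat_act M x \<in> L}" for x
  proof -
    have "y \<in> mat_act M ` {z. z - x \<in> Lambda0}" if "y - mat_act M x \<in> L" for y
    proof (rule image_eqI)
      show "y = mat_act M (mat_act \<alpha> y)" by (simp add: inv)
      have "mat_act M (mat_act \<alpha> y - x) \<in> L" using that by (simp add: diff inv)
      then show "mat_act \<alpha> y \<in> {z. z - x \<in> Lambda0}" by (simp add: inL)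
    qed
    then show ?thesis by (auto simp: diff[symmetric] inL)
  qed
  have Ladd: "x + y \<in> L" if "x \<in> L" "y \<in> L" for x y
    using that Lambda0_add unfolding L_def by (auto simp: mat_act_add[symmetric])
  have Lminus: "- x \<in> L" if xL: "x \<in> L" for x
  proof -
    obtain z where z: "z \<in> Lambda0" "x = mat_act M z" using xL unfolding L_def by blast
    have "- x = mat_act M (- z)" using diff[of M 0 z] zero z(2) by simp
    then show ?thesis using inL Lambda0_minus[OF z(1)] by simp
  qed
  have e: "mat_act M (of_int m * e1 + of_int n * e2) = of_int m * mat_act M e1 + of_int n * mat_act M e2" for m n
    using mat_act_scale[of M "of_int m" e1] mat_act_scale[of M "of_int n" e2] by (simp add: mat_act_add)
  have "complex_lattice L"
    unfolding complex_lattice_def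
  proof (intro exI conjI)
    have ind: "a = 0 \<and> b = 0" if "of_real a * mat_act M e1 + of_real b * mat_act M e2 = 0" for a b
    proof -
      have "mat_act M (of_real a * e1 + of_real b * e2) = 0"
        using that by (simp add: mat_act_add mat_act_scale)
      then have "of_real a * e1 + of_real b * e2 = 0"
        using inv(1)[of "of_real a * e1 + of_real b * e2"] zero by simp
      then show ?thesis by (simp add: e1_def e2_def complex_eq_iff)
    qed
    show ne: "mat_act M e1 \<noteq> mat_act M e2"
      using ind[of 1 "-1"] by auto
    show "independent {mat_act M e1, mat_act M e2}"
      using ne ind[of 1 0] ind[of 0 1]
      by (auto simp: independent_insert span_singleton scaleR_conv_of_real)
        (metis ind add.right_inverse diff_conv_add_uminus mult_1 mult_minus_left of_real_1 of_real_minus zero_neq_one)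
    show "L = {of_int m * mat_act M e1 + of_int n * mat_act M e2 | m n. True}"
      unfolding L_def Lambda0_def by (auto simp: e[symmetric])
  qed
  have coset: "L #>\<^bsub>additive_group (rational_span L)\<^esub> x = {y. y - x \<in> L}" for x
  proof -
    have "w \<in> (\<lambda>h. h + x) ` L" if "w - x \<in> L" for w
      using that by (intro image_eqI[of _ _ "w - x"]) auto
    then show ?thesis unfolding r_coset_def additive_group_def by fastforce
  qed
  define \<phi> where "\<phi> = restrict (\<lambda>t. mat_act M ` rho_map \<rho> t) (carrier Q2_mod_Z2)"
  have carr: "t \<in> carrier Q2_mod_Z2 \<longleftrightarrow> (\<exists>a. t = {w. \<forall>i. (w - a) $ i \<in> \<int>})" for t
    by (auto simp: Q2_mod_Z2_def FactGroup_def RCOSETS_def Z2_coset) (auto simp: additive_group_def)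
  have phi: "\<phi> {w. \<forall>i. (w - a) $ i \<in> \<int>} = {y. y - mat_act M (rho_rep \<rho> a) \<in> L}" for a
  proof -
    have "{w. \<forall>i. (w - a) $ i \<in> \<int>} \<in> carrier Q2_mod_Z2" using carr by blast
    then show ?thesis unfolding \<phi>_def by (simp only: restrict_apply if_True rho_map_coset img)
  qed
  have span: "mat_act M (rho_rep \<rho> a) \<in> rational_span L" for a
  proof -
    obtain p q where pq: "rho_rep \<rho> a = of_rat p * e1 + of_rat q * e2" unfolding rho_rep_def by blast
    obtain m where m: "0 < m" "of_nat m * p \<in> \<int>" using rat_denominator by blast
    obtain n where n: "0 < n" "of_nat n * q \<in> \<int>" using rat_denominator by blast
    have p: "of_nat (m * n) * p \<in> \<int>"
      using Ints_mult[OF Ints_of_nat[of n] m(2)] by (simp add: mult.assoc mult.left_commute)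
    have q: "of_nat (m * n) * q \<in> \<int>"
      using Ints_mult[OF Ints_of_nat[of m] n(2)] by (simp add: mult.assoc mult.left_commute)
    let ?N = "of_nat (m * n) :: complex"
    have "?N * rho_rep \<rho> a \<in> Lambda0"
      using Lambda0I[OF p q] unfolding pq by (simp add: of_rat_mult algebra_simps)
    then have "?N * mat_act M (rho_rep \<rho> a) \<in> L"
      using inL[of "?N * rho_rep \<rho> a"] mat_act_scale[of M "of_nat (m * n)" "rho_rep \<rho> a"]
      by (simp del: of_nat_mult)
    moreover have "mat_act M (rho_rep \<rho> a) = of_rat (1 / of_nat (m * n)) * (?N * mat_act M (rho_rep \<rho> a))"
      using m n by (simp add: of_rat_divide of_rat_mult)
    ultimately show ?thesis unfolding rational_span_def by blast
  qed
  have "\<phi> \<in> hom Q2_mod_Z2 (span_mod_lattice L)"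
  proof (rule homI)
    fix t assume "t \<in> carrier Q2_mod_Z2"
    then obtain a where a: "t = {w. \<forall>i. (w - a) $ i \<in> \<int>}" unfolding carr by (elim exE)
    show "\<phi> t \<in> carrier (span_mod_lattice L)"
      unfolding a phi span_mod_lattice_def FactGroup_def RCOSETS_def coset
      unfolding monoid.simps partial_object.simps additive_group_def using span[of a] by fast
  next
    fix s t assume "s \<in> carrier Q2_mod_Z2" "t \<in> carrier Q2_mod_Z2"
    then obtain a b where a: "s = {w. \<forall>i. (w - a) $ i \<in> \<int>}" and b: "t = {w. \<forall>i. (w - b) $ i \<in> \<int>}"
      unfolding carr by (elim exE)
    have st: "s \<otimes>\<^bsub>Q2_mod_Z2\<^esub> t = {w. \<forall>i. (w - (a + b)) $ i \<in> \<int>}"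
    proof -
      have st: "s \<otimes>\<^bsub>Q2_mod_Z2\<^esub> t = {x + y | x y. x \<in> s \<and> y \<in> t}"
        unfolding Q2_mod_Z2_def FactGroup_def set_mult_def additive_group_def monoid.simps by blast
      show ?thesis
        unfolding st
      proof (intro equalityI subsetI)
        fix w assume "w \<in> {x + y | x y. x \<in> s \<and> y \<in> t}"
        then obtain x y where xy: "w = x + y" "x \<in> s" "y \<in> t" by blast
        have "(w - (a + b)) $ i \<in> \<int>" for i
        proof -
          have "(x - a) $ i + (y - b) $ i \<in> \<int>" using xy unfolding a b by (intro Ints_add) auto
          then show ?thesis by (simp add: algebra_simps xy)
        qed
        then show "w \<in> {w. \<forall>i. (w - (a + b)) $ i \<in> \<int>}" by simp
      next
        fix w assume w: "w \<in> {w. \<forall>i. (w - (a + b)) $ i \<in> \<int>}"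
        have "w = a + (w - a)" by simp
        moreover have "a \<in> s" unfolding a by simp
        moreover have "w - a \<in> t" using w unfolding b by (simp add: diff_diff_add)
        ultimately show "w \<in> {x + y | x y. x \<in> s \<and> y \<in> t}" by blast
      qed
    qed
    have L: "y - mat_act M (rho_rep \<rho> (a + b)) \<in> L \<longleftrightarrow> y - (mat_act M (rho_rep \<rho> a) + mat_act M (rho_rep \<rho> b)) \<in> L" for y
    proof -
      have d: "mat_act M (rho_rep \<rho> (a + b)) - (mat_act M (rho_rep \<rho> a) + mat_act M (rho_rep \<rho> b)) \<in> L"
        using rho_rep_add[of \<rho> a b] inL by (simp only: mat_act_add[symmetric] diff[symmetric])
      let ?p = "mat_act M (rho_rep \<rho> (a + b))" and ?q = "mat_act M (rho_rep \<rho> a) + mat_act M (rho_rep \<rho> b)"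
      have "y - ?q = (y - ?p) + (?p - ?q)" "y - ?p = (y - ?q) + - (?p - ?q)"
        by (simp_all add: algebra_simps)
      then show ?thesis
        using Ladd[OF _ d] Ladd[OF _ Lminus[OF d]] by metis
    qed
    have "{y. y - (u + v) \<in> L} = {y. y - u \<in> L} <#>\<^bsub>additive_group (rational_span L)\<^esub> {y. y - v \<in> L}" for u v
    proof (intro equalityI subsetI)
      fix y assume y: "y \<in> {y. y - (u + v) \<in> L}"
      have u: "u \<in> {y. y - u \<in> L}" using inL[of 0] zero Lambda0I[of 0 0] by simp
      have "y - u - v \<in> L" using y by (simp only: mem_Collect_eq diff_diff_add)
      then have v: "y - u \<in> {y. y - v \<in> L}" by simp
      have "y = u + (y - u)" by simp
      with u v show "y \<in> {y. y - u \<in> L} <#>\<^bsub>additive_group (rational_span L)\<^esub> {y. y - v \<in> L}"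
        unfolding set_mult_def additive_group_def monoid.simps by blast
    next
      fix w assume "w \<in> {y. y - u \<in> L} <#>\<^bsub>additive_group (rational_span L)\<^esub> {y. y - v \<in> L}"
      then obtain x y where xy: "x - u \<in> L" "y - v \<in> L" "w = x + y"
        unfolding set_mult_def additive_group_def monoid.simps by blast
      have "w - (u + v) = (x - u) + (y - v)" unfolding xy(3) by simp
      then show "w \<in> {y. y - (u + v) \<in> L}" using Ladd[OF xy(1,2)] by (simp only: mem_Collect_eq)
    qed
    then show "\<phi> (s \<otimes>\<^bsub>Q2_mod_Z2\<^esub> t) = \<phi> s \<otimes>\<^bsub>span_mod_lattice L\<^esub> \<phi> t"
      unfolding st unfolding a b phi L span_mod_lattice_def FactGroup_def monoid.simps .
  qed
  moreover have "\<phi> \<in> extensional (carrier Q2_mod_Z2)" by (simp add: \<phi>_def)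
  moreover have "Q_lattice_of \<rho> \<alpha> = (L, \<phi>)" by (simp add: Q_lattice_of_def L_def \<phi>_def M_def)
  ultimately show ?thesis using \<open>complex_lattice L\<close> by (simp add: Q_lattice_def)
qed

definition parabolic_Q_lattices :: "lattice_pair set" where
  "parabolic_Q_lattices = {X. Q_lattice X \<and> (\<exists>\<rho>\<in>P_bar. \<exists>\<alpha>\<in>P_plus. X = Q_lattice_of \<rho> \<alpha>)}"

section \<open>The two quotient spaces\<close>

definition quotient_topology :: "'a topology \<Rightarrow> ('a \<Rightarrow> 'b) \<Rightarrow> 'b topology" where
  "quotient_topology X f =
    topology (\<lambda>U. U \<subseteq> f ` topspace X \<and> openin X {x \<in> topspace X. f x \<in> U})"

lemma openin_quotient_topology:
  "openin (quotient_topology X f) U \<longleftrightarrow>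
    U \<subseteq> f ` topspace X \<and> openin X {x \<in> topspace X. f x \<in> U}"
proof -
  have "istopology (\<lambda>U. U \<subseteq> f ` topspace X \<and> openin X {x \<in> topspace X. f x \<in> U})"
    unfolding istopology_def
  proof (intro conjI allI impI)
    fix S T
    assume a: "S \<subseteq> f ` topspace X \<and> openin X {x \<in> topspace X. f x \<in> S}"
      "T \<subseteq> f ` topspace X \<and> openin X {x \<in> topspace X. f x \<in> T}"
    have "{x \<in> topspace X. f x \<in> S \<inter> T} = {x \<in> topspace X. f x \<in> S} \<inter> {x \<in> topspace X. f x \<in> T}"
      by auto
    with a show "openin X {x \<in> topspace X. f x \<in> S \<inter> T}"
      by auto
    show "S \<inter> T \<subseteq> f ` topspace X"
      using a by auto
  next
    fix K assume a: "\<forall>S\<in>K. S \<subseteq> f ` topspace X \<and> openin X {x \<in> topspace X. f x \<in> S}"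
    have "{x \<in> topspace X. f x \<in> \<Union>K} = (\<Union>S\<in>K. {x \<in> topspace X. f x \<in> S})"
      by auto
    with a show "openin X {x \<in> topspace X. f x \<in> \<Union>K}"
      by auto
    show "\<Union>K \<subseteq> f ` topspace X"
      using a by auto
  qed
  then show ?thesis
    by (simp add: quotient_topology_def topology_inverse')
qed

lemma topspace_quotient_topology: "topspace (quotient_topology X f) = f ` topspace X"
proof
  show "topspace (quotient_topology X f) \<subseteq> f ` topspace X"
    using openin_quotient_topology[of X f] openin_topspace by blast
  have "{x \<in> topspace X. f x \<in> f ` topspace X} = topspace X"
    by auto
  then show "f ` topspace X \<subseteq> topspace (quotient_topology X f)"
    by (intro openin_subset) (simp add: openin_quotient_topology)
qed

lemma quotient_map_quotient_topology: "quotient_map X (quotient_topology X f) f"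
  by (auto simp: quotient_map_def topspace_quotient_topology openin_quotient_topology)

text \<open>The space of parabolic \<open>\<rat>\<close>-lattices carries the quotient topology of its parametrization
  by pairs of matrices.\<close>

definition parabolic_topology :: "lattice_pair topology" where
  "parabolic_topology =
    quotient_topology (top_of_set (P_bar \<times> P_plus)) (\<lambda>(\<rho>, \<alpha>). Q_lattice_of \<rho> \<alpha>)"

definition commensurability_class :: "lattice_pair \<Rightarrow> lattice_pair set" where
  "commensurability_class X = {Y \<in> parabolic_Q_lattices. commensurable X Y}"

definition commensurability_space :: "lattice_pair set topology" where
  "commensurability_space = quotient_topology parabolic_topology commensurability_class"

type_synonym adelic_pair = "(finite_adele^2^2) \<times> (real^2^2)"

definition P_plus_Q_act :: "rat^2^2 \<Rightarrow> adelic_pair \<Rightarrow> adelic_pair" where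
  "P_plus_Q_act g = (\<lambda>(\<rho>, \<alpha>). (map_matrix adele_of_rat g ** \<rho>, map_matrix of_rat g ** \<alpha>))"

definition P_plus_Q_orbit :: "adelic_pair \<Rightarrow> adelic_pair set" where
  "P_plus_Q_orbit x = {P_plus_Q_act g x | g. g \<in> P_plus}"

definition adelic_quotient :: "adelic_pair set topology" where
  "adelic_quotient = quotient_topology (top_of_set (P_bar \<times> P_plus)) P_plus_Q_orbit"

end

theory Submission
  imports Defs
begin

text \<open>
  Write \<open>\<alpha>j\<close> for the two real parabolic matrices, \<open>\<rho>j\<close> for the two integral ones and
  \<open>\<gamma> = \<alpha>2 \<alpha>1\<^sup>-\<^sup>1\<close>.  Any \<open>g\<close> as in the first part must equal \<open>\<gamma>\<close>, so the question is when \<open>\<gamma>\<close> is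
  rational and \<open>\<rho>2 = \<gamma> \<rho>1\<close> over the finite adeles.  Applying \<open>\<alpha>2\<close> to both lattices turns
  commensurability into two conditions on \<open>\<gamma>\<close> (\<open>commensurable_iff_relative_matrix\<close>).

  The condition on the rational spans is that \<open>\<gamma>\<close> preserves \<open>\<rat>e1 + \<rat>e2\<close>; for a parabolic matrix this
  means that its entries \<open>c\<close>, \<open>d\<close> are rational.  The condition on the torsion points is that
  \<open>\<gamma> \<rho>1 v - \<rho>2 v\<close> lies in \<open>\<gamma> Lambda0 + Lambda0\<close> for every rational \<open>v\<close>.  The second coordinate of
  this difference vanishes because both \<open>\<rho>j\<close> have bottom row \<open>(0, 1)\<close>, so the first coordinate has to lie
  in the fractional ideal \<open>\<int>c + \<int>d + \<int>\<close>.  Vanishing only modulo this ideal is as strong as an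
  exact identity of adeles (\<open>adelic_combination_iff_pointwise\<close>): if \<open>n\<close> is a common denominator of \<open>c\<close>
  and \<open>d\<close>, then multiplication by \<open>n\<close> maps the ideal into \<open>\<int>\<close>, and a profinite integer which kills all
  of \<open>\<rat>/\<int>\<close> is zero.  In the other direction \<open>n\<close> can be removed again because \<open>\<rat>/\<int>\<close> is divisible.

  For the second part, the integral pairs \<open>P_bar \<times> P_plus\<close> over the profinite integers map to both
  spaces.  By the first part the two maps have the same fibres, and both are quotient maps: for
  the commensurability space this is the definition of its topology; for the adelic quotient
  it holds because the profinite integers are an open subring of the adeles, orbit
  maps of groups acting by homeomorphisms are open, and every adelic pair has
  an integral representative obtained by clearing denominators with \<open>diag(N, 1)\<close>.  Two quotients of
  one space with the same fibres are homeomorphic.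
\<close>

section \<open>Profinite integers acting on rationals modulo integers\<close>

lemma residue_of_int: "0 < n \<Longrightarrow> residue (of_int k) n = k mod int n"
proof (cases k)
  case (nonneg m)
  assume "0 < n"
  then show ?thesis using nonneg residue_of_nat[of n m] by simp
next
  case (neg m)
  assume n: "0 < n"
  have "residue (of_int k) n = (- residue (of_nat (Suc m)) n) mod int n"
    unfolding neg of_int_minus of_int_of_nat_eq uminus_zhat.rep_eq ..
  then show ?thesis
    unfolding residue_of_nat[OF n] neg by (simp add: mod_minus_eq)
qed

lemma residue_mult_of_nat_self [simp]: "residue (of_nat n * z) n = 0"
  by (cases "n = 0") (simp_all add: times_zhat.rep_eq residue_of_nat)

text \<open>
  The kernel of reduction modulo \<open>n\<close> is \<open>n\<close> times the ring.  The subspace topology defined by residues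
  and the adelic topology defined by these multiples agree for this reason.
\<close>

lemma residue_eq_0_imp_multiple:
  assumes n: "0 < n" and w: "residue w n = 0"
  shows "\<exists>z. w = of_nat n * z"
proof -
  \<comment> \<open>The residue of the quotient modulo \<open>m\<close> is visible in \<open>w\<close> modulo \<open>n * m\<close> only.\<close>
  define f where "f m = residue w (n * m) div int n" for m
  have fn: "residue w (n * m) = int n * f m" if "0 < m" for m
  proof -
    have "residue w (n * m) mod int n = 0"
      using residue_mod_dvd[of "n * m" n w] n w that by simp
    then show ?thesis unfolding f_def by (simp add: mod_eq_0_iff_dvd)
  qed
  have "f k mod int m = f m" if k: "0 < k" "m dvd k" for m k
  proof -
    have m: "0 < m" using k by (auto intro: Nat.gr0I)
    have "int n * (f k mod int m) = residue w (n * k) mod int (n * m)"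
      unfolding fn[OF k(1)] by (simp only: mult_mod_right of_nat_mult)
    also have "\<dots> = int n * f m"
      using residue_mod_dvd[of "n * k" "n * m" w] n k fn[OF m] by simp
    finally show ?thesis using n by simp
  qed
  then have z: "residue (Abs_zhat f) = f"
    by (intro Abs_zhat_inverse) (auto simp: f_def)
  have "w = of_nat n * Abs_zhat f"
  proof (rule zhat_eqI)
    fix m :: nat assume m: "0 < m"
    have "residue w m = (int n * f m) mod int m"
      unfolding fn[OF m, symmetric] using residue_mod_dvd[of "n * m" m w] n m by simp
    also have "\<dots> = residue (of_nat n * Abs_zhat f) m"
      using m by (simp add: times_zhat.rep_eq residue_of_nat z mod_mult_left_eq)
    finally show "residue w m = residue (of_nat n * Abs_zhat f) m" .
  qed
  then show ?thesis ..
qed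

lemma zhat_act_zero [simp]: "zhat_act 0 q = 0" "zhat_act x 0 = 0"
  by (simp_all add: zhat_act_def zero_zhat.rep_eq)

text \<open>
  Modulo integers, \<open>q\<close> may be multiplied by any integer congruent to \<open>x\<close> modulo a denominator of \<open>q\<close>.
  Additivity and compatibility with integer multiples are read off from this.
\<close>

lemma zhat_act_mod_eq:
  assumes n: "0 < n" "of_nat n * q \<in> \<int>" and k: "residue x n = k mod int n"
  shows "zhat_act x q - of_int k * q \<in> \<int>"
proof -
  obtain a where a: "of_nat n * q = of_int a" using n(2) by (rule Ints_cases)
  have "of_int k * q = of_int (k mod int n) * q + of_int (k div int n) * (of_nat n * q)"
    using arg_cong[OF mod_mult_div_eq[of k "int n"], of "\<lambda>t. of_int t * q"]
    by (simp only: of_int_add of_int_mult of_int_of_nat_eq algebra_simps)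
  then have "zhat_act x q - of_int k * q
      = (zhat_act x q - of_int (residue x n) * q) - of_int (k div int n) * of_int a"
    unfolding a k by simp
  then show ?thesis
    using zhat_act_denominator[OF n, of x] by (simp only: Ints_diff Ints_mult Ints_of_int)
qed

lemma zhat_act_add_left: "zhat_act (x + y) q - (zhat_act x q + zhat_act y q) \<in> \<int>"
proof -
  obtain n where n: "0 < n" "of_nat n * q \<in> \<int>" using rat_denominator by blast
  have "zhat_act (x + y) q - of_int (residue x n + residue y n) * q \<in> \<int>"
    by (rule zhat_act_mod_eq[OF n]) (simp add: plus_zhat.rep_eq)
  from Ints_diff[OF this Ints_add[OF zhat_act_denominator[OF n, of x] zhat_act_denominator[OF n, of y]]]
  show ?thesis by (simp add: algebra_simps)
qed

lemma zhat_act_of_int_mult: "zhat_act (of_int k * x) q - of_int k * zhat_act x q \<in> \<int>"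
proof -
  obtain n where n: "0 < n" "of_nat n * q \<in> \<int>" using rat_denominator by blast
  have "zhat_act (of_int k * x) q - of_int (k * residue x n) * q \<in> \<int>"
    by (rule zhat_act_mod_eq[OF n])
      (simp add: times_zhat.rep_eq residue_of_int[OF n(1)] mod_mult_left_eq)
  from Ints_diff[OF this Ints_mult[OF Ints_of_int[of k] zhat_act_denominator[OF n, of x]]]
  show ?thesis by (simp add: algebra_simps)
qed

lemma zhat_act_of_nat_arg: "zhat_act x (of_nat k * q) - of_nat k * zhat_act x q \<in> \<int>"
proof -
  obtain n where n: "0 < n" "of_nat n * q \<in> \<int>" using rat_denominator by blast
  have nk: "of_nat n * (of_nat k * q) \<in> \<int>"
    using Ints_mult[OF Ints_of_nat[of k] n(2)] by (simp add: mult.left_commute)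
  from Ints_diff[OF zhat_act_denominator[OF n(1) nk, of x]
      Ints_mult[OF Ints_of_nat[of k] zhat_act_denominator[OF n, of x]]]
  show ?thesis by (simp add: algebra_simps)
qed

text \<open>
  Testing on \<open>1/n\<close> recovers the residue modulo \<open>n\<close>.
\<close>

lemma zhat_act_faithful:
  assumes "\<And>q. zhat_act x q \<in> \<int>"
  shows "x = 0"
proof (rule zhat_eqI)
  fix n :: nat assume n: "0 < n"
  have "zhat_act x (1 / of_nat n) - of_int (residue x n) * (1 / of_nat n) \<in> \<int>"
    using n by (intro zhat_act_denominator) auto
  from Ints_diff[OF assms[of "1 / of_nat n"] this] have "of_int (residue x n) / of_nat n \<in> (\<int> :: rat set)"
    by simp
  then obtain k where "(of_int (residue x n) :: rat) / of_nat n = of_int k"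
    by (rule Ints_cases)
  then have "(of_int (residue x n) :: rat) = of_int (int n * k)"
    using n by (simp add: field_simps)
  then have "residue x n = int n * k" by (simp only: of_int_eq_iff)
  then show "residue x n = residue 0 n"
    using residue_mod[of x n] by (simp add: zero_zhat.rep_eq)
qed

section \<open>The rationals and the profinite integers inside the finite adeles\<close>

lemma rat_fraction:
  fixes q :: rat
  obtains k n where "0 < n" "q = of_int k / of_nat n"
proof -
  obtain n where "0 < n" "of_nat n * q \<in> \<int>" using rat_denominator by blast
  moreover from this obtain k where "of_nat n * q = of_int k" by (elim Ints_cases)
  ultimately show ?thesis using that[of n k] by (simp add: field_simps)
qed

lemma rat_common_denominator:
  fixes p q :: rat
  obtains k l n where "0 < n" "p = of_int k / of_nat n" "q = of_int l / of_nat n"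
proof -
  obtain k m where p: "0 < m" "p = of_int k / of_nat m" by (rule rat_fraction)
  obtain l n where q: "0 < n" "q = of_int l / of_nat n" by (rule rat_fraction)
  show ?thesis
    using p q by (intro that[of "m * n" "k * int n" "l * int m"]) simp_all
qed

text \<open>
  Any fraction may be used for the embedding of \<open>\<rat>\<close>, not only the reduced one of its definition; this
  makes additivity and multiplicativity computations with fractions.
\<close>

lemma adele_of_rat_fraction:
  assumes n: "0 < n"
  shows "adele_of_rat (of_int k / of_nat n) = adele_frac (of_int k) n"
proof -
  obtain a d where ad: "quotient_of (of_int k / of_nat n) = (a, d)" by fastforce
  have d: "0 < d" using quotient_of_denom_pos[OF ad] .
  have "(of_int (int n * a) :: rat) = of_int (d * k)"
    using quotient_of_div[OF ad] n d by (simp add: field_simps)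
  then have "int n * a = d * k" by (simp only: of_int_eq_iff)
  then have "(of_int (int n * a) :: zhat) = of_int (d * k)" by (rule arg_cong)
  moreover have "(of_nat (nat d) :: zhat) = of_int d" using d by (simp add: of_nat_nat)
  ultimately show ?thesis
    unfolding adele_of_rat_def ad using d n by (simp add: adele_frac_eq_iff)
qed

lemma adele_of_rat_of_int: "adele_of_rat (of_int k) = adele_of_zhat (of_int k)"
  using adele_of_rat_fraction[of 1 k] by (simp add: adele_of_zhat_def)

lemma adele_of_zhat_0 [simp]: "adele_of_zhat 0 = 0"
  unfolding adele_of_zhat_def by transfer (simp add: adele_rel_def)

lemma adele_of_zhat_1 [simp]: "adele_of_zhat 1 = 1"
  unfolding adele_of_zhat_def by transfer (simp add: adele_rel_def)

lemma adele_of_zhat_add: "adele_of_zhat (x + y) = adele_of_zhat x + adele_of_zhat y"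
  by (simp add: adele_of_zhat_def adele_frac_add)

lemma adele_of_rat_0 [simp]: "adele_of_rat 0 = 0"
  using adele_of_rat_of_int[of 0] by simp

lemma adele_of_rat_1 [simp]: "adele_of_rat 1 = 1"
  using adele_of_rat_of_int[of 1] by simp

lemma adele_of_rat_add: "adele_of_rat (p + q) = adele_of_rat p + adele_of_rat q"
proof -
  obtain k m where p: "0 < m" "p = of_int k / of_nat m" by (rule rat_fraction)
  obtain l n where q: "0 < n" "q = of_int l / of_nat n" by (rule rat_fraction)
  have "p + q = of_int (int n * k + int m * l) / of_nat (m * n)"
    using p q by (simp add: field_simps)
  then show ?thesis
    unfolding p(2) q(2) using p(1) q(1)
    by (simp only: adele_of_rat_fraction adele_frac_add nat_0_less_mult_iff)
      (simp add: algebra_simps)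
qed

lemma adele_of_rat_mult: "adele_of_rat (p * q) = adele_of_rat p * adele_of_rat q"
proof -
  obtain k m where p: "0 < m" "p = of_int k / of_nat m" by (rule rat_fraction)
  obtain l n where q: "0 < n" "q = of_int l / of_nat n" by (rule rat_fraction)
  have "p * q = of_int (k * l) / of_nat (m * n)"
    using p q by (simp add: field_simps)
  then show ?thesis
    unfolding p(2) q(2) using p(1) q(1)
    by (simp only: adele_of_rat_fraction adele_frac_mult nat_0_less_mult_iff) simp
qed

text \<open>
  Clearing the common denominator is an equivalence because the profinite integers are
  torsion-free.
\<close>

lemma adele_of_zhat_eq_combination_iff:
  assumes n: "0 < n"
  shows "adele_of_zhat z = adele_of_rat (of_int k / of_nat n) * adele_of_zhat x
      + adele_of_rat (of_int l / of_nat n) * adele_of_zhat y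
    \<longleftrightarrow> of_nat n * z = of_int k * x + of_int l * y"
proof -
  have "adele_of_rat (of_int k / of_nat n) * adele_of_zhat x
      + adele_of_rat (of_int l / of_nat n) * adele_of_zhat y
    = adele_frac (of_nat n * (of_int k * x + of_int l * y)) (n * n)"
    using n by (simp add: adele_of_rat_fraction adele_of_zhat_def adele_frac_mult adele_frac_add
        distrib_left)
  moreover have "of_nat (n * n) * z = of_nat n * (of_nat n * z)" by simp
  ultimately have "(adele_of_zhat z = adele_of_rat (of_int k / of_nat n) * adele_of_zhat x
      + adele_of_rat (of_int l / of_nat n) * adele_of_zhat y)
    \<longleftrightarrow> of_nat n * (of_nat n * z) = of_nat n * (of_int k * x + of_int l * y)"
    using n adele_frac_eq_iff[of 1 "n * n" z "of_nat n * (of_int k * x + of_int l * y)"]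
    by (simp only: adele_of_zhat_def) simp
  also have "\<dots> \<longleftrightarrow> of_nat n * z = of_int k * x + of_int l * y"
    by (rule iffI, rule zhat_cancel[OF n]) simp_all
  finally show ?thesis .
qed

text \<open>
  For \<open>\<gamma>\<close> with top row \<open>(c, d)\<close> this group is the set of first coordinates of those points of
  \<open>\<gamma> Lambda0 + Lambda0\<close> whose second coordinate is zero.
\<close>

definition fractional_ideal :: "rat \<Rightarrow> rat \<Rightarrow> rat set" where
  "fractional_ideal c d = {c * of_int m + d * of_int n + of_int k | m n k. True}"

lemma fractional_idealI:
  "m \<in> \<int> \<Longrightarrow> n \<in> \<int> \<Longrightarrow> k \<in> \<int> \<Longrightarrow> c * m + d * n + k \<in> fractional_ideal c d"
  unfolding fractional_ideal_def mem_Collect_eq by (elim Ints_cases) (intro exI conjI TrueI, simp)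

lemma fractional_idealE:
  assumes "u \<in> fractional_ideal c d"
  obtains m n k where "u = c * of_int m + d * of_int n + of_int k"
  using assms unfolding fractional_ideal_def by auto

lemma fractional_ideal_add:
  "u \<in> fractional_ideal c d \<Longrightarrow> v \<in> fractional_ideal c d \<Longrightarrow> u + v \<in> fractional_ideal c d"
proof -
  assume "u \<in> fractional_ideal c d" "v \<in> fractional_ideal c d"
  then obtain m n k m' n' k' where uv: "u = c * of_int m + d * of_int n + of_int k"
      "v = c * of_int m' + d * of_int n' + of_int k'"
    by (elim fractional_idealE)
  have "u + v = c * of_int (m + m') + d * of_int (n + n') + of_int (k + k')"
    unfolding uv by (simp add: algebra_simps)
  then show ?thesis by (simp only: fractional_idealI Ints_of_int)
qed

text \<open>
  The pointwise condition is a congruence modulo a group that can be larger than \<open>\<int>\<close>, yet it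
  determines \<open>z\<close>.  With \<open>c = k/n\<close> and \<open>d = l/n\<close>, put \<open>w = k x + l y - n z\<close>.  Multiplication by \<open>n\<close> sends the
  ideal into \<open>\<int>\<close>, so the pointwise condition makes \<open>w\<close> act trivially on \<open>\<rat>/\<int>\<close>, hence \<open>w = 0\<close>.  Conversely, if
  \<open>w = 0\<close>, evaluate at \<open>q = n p\<close>: replacing the action on \<open>n p\<close> by \<open>n\<close> times the action on \<open>p\<close> changes the
  value by integers, which contribute \<open>c\<close>, \<open>d\<close> and \<open>1\<close> times integers, that is, an element of the ideal.
\<close>

lemma adelic_combination_iff_pointwise:
  "adele_of_zhat z = adele_of_rat c * adele_of_zhat x + adele_of_rat d * adele_of_zhat y
    \<longleftrightarrow> (\<forall>q. c * zhat_act x q + d * zhat_act y q - zhat_act z q \<in> fractional_ideal c d)"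
proof -
  obtain k l n where n: "0 < n" and c: "c = of_int k / of_nat n" and d: "d = of_int l / of_nat n"
    by (rule rat_common_denominator)
  define w where "w = of_int k * x + of_int l * y + of_int (- int n) * z"
  have w0: "adele_of_zhat z = adele_of_rat c * adele_of_zhat x + adele_of_rat d * adele_of_zhat y
      \<longleftrightarrow> w = 0"
    unfolding c d adele_of_zhat_eq_combination_iff[OF n] w_def by auto
  have w: "zhat_act w q - (of_int k * zhat_act x q + of_int l * zhat_act y q
      - of_nat n * zhat_act z q) \<in> \<int>" for q
    using Ints_add[OF Ints_add[OF zhat_act_add_left[of "of_int k * x + of_int l * y" "of_int (- int n) * z" q]
        zhat_act_add_left[of "of_int k * x" "of_int l * y" q]]
      Ints_add[OF Ints_add[OF zhat_act_of_int_mult[of k x q] zhat_act_of_int_mult[of l y q]]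
        zhat_act_of_int_mult[of "- int n" z q]]]
    unfolding w_def by (simp add: algebra_simps)
  have nc: "of_nat n * c = of_int k" and nd: "of_nat n * d = of_int l" using n c d by auto
  show ?thesis
    unfolding w0
  proof
    assume "w = 0"
    show "\<forall>q. c * zhat_act x q + d * zhat_act y q - zhat_act z q \<in> fractional_ideal c d"
    proof
      fix q :: rat
      \<comment> \<open>Divisibility of \<open>\<rat>\<close> lets the denominator \<open>n\<close> be moved into the argument.\<close>
      define p where "p = q / of_nat n"
      have q: "q = of_nat n * p" unfolding p_def using n by simp
      define r where "r t = zhat_act t q - of_nat n * zhat_act t p" for t
      have r: "r t \<in> \<int>" for t unfolding r_def q by (rule zhat_act_of_nat_arg)
      have e: "zhat_act t q = of_nat n * zhat_act t p + r t" for t by (simp add: r_def)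
      have "c * zhat_act x q + d * zhat_act y q - zhat_act z q
        = c * r x + d * r y + ((of_nat n * c) * zhat_act x p + (of_nat n * d) * zhat_act y p
            - of_nat n * zhat_act z p - r z)"
        unfolding e by (simp add: algebra_simps)
      also have "\<dots> \<in> fractional_ideal c d"
        using w[of p] unfolding nc nd \<open>w = 0\<close> zhat_act_zero diff_0 minus_in_Ints_iff
        by (intro fractional_idealI Ints_diff[OF _ r] r)
      finally show "c * zhat_act x q + d * zhat_act y q - zhat_act z q \<in> fractional_ideal c d" .
    qed
  next
    assume *: "\<forall>q. c * zhat_act x q + d * zhat_act y q - zhat_act z q \<in> fractional_ideal c d"
    show "w = 0"
    proof (rule zhat_act_faithful)
      fix q :: rat
      obtain m m' j where "c * zhat_act x q + d * zhat_act y q - zhat_act z q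
          = c * of_int m + d * of_int m' + of_int j"
        using *[rule_format, of q] by (rule fractional_idealE)
      from arg_cong[OF this, of "\<lambda>t. of_nat n * t"]
      have "(of_nat n * c) * zhat_act x q + (of_nat n * d) * zhat_act y q - of_nat n * zhat_act z q
          = (of_nat n * c) * of_int m + (of_nat n * d) * of_int m' + of_nat n * of_int j"
        by (simp add: algebra_simps)
      then have e: "of_int k * zhat_act x q + of_int l * zhat_act y q - of_nat n * zhat_act z q
          = of_int (k * m + l * m' + int n * j)"
        unfolding nc nd by simp
      show "zhat_act w q \<in> \<int>"
        using Ints_add[OF w[of q, unfolded e] Ints_of_int[of "k * m + l * m' + int n * j"]]
        by (simp only: diff_add_cancel)
    qed
  qed
qed

section \<open>Parabolic matrices\<close>

lemma parabolic_matrix_nth [simp]: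
  "parabolic_matrix a b $ 1 $ 1 = a" "parabolic_matrix a b $ 1 $ 2 = b"
  "parabolic_matrix a b $ 2 $ 1 = 0" "parabolic_matrix a b $ 2 $ 2 = 1"
  by (simp_all add: parabolic_matrix_def)

lemma parabolic_matrix_eq_iff:
  "parabolic_matrix a b = parabolic_matrix a' b' \<longleftrightarrow> a = a' \<and> b = b'"
  by (auto simp: vec_eq_iff forall_2)

lemma parabolic_matrix_mult:
  "parabolic_matrix a b ** parabolic_matrix a' b' = parabolic_matrix (a * a') (a * b' + b)"
  by (simp add: vec_eq_iff forall_2 matrix_matrix_mult_def sum_2)

lemma parabolic_matrix_one: "parabolic_matrix 1 0 = mat 1"
  by (simp add: vec_eq_iff forall_2 mat_def)

lemma map_matrix_parabolic:
  "f 0 = 0 \<Longrightarrow> f 1 = 1 \<Longrightarrow> map_matrix f (parabolic_matrix a b) = parabolic_matrix (f a) (f b)"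
  by (simp add: vec_eq_iff forall_2)

text \<open>
  Over a field the invertibility demanded in the definition is a consequence of positivity.
\<close>

lemma P_plus_iff:
  fixes M :: "'a::linordered_field^2^2"
  shows "M \<in> P_plus \<longleftrightarrow> (\<exists>a b. 0 < a \<and> M = parabolic_matrix a b)"
  unfolding P_plus_def by (auto simp: dvd_field_iff)

lemma parabolic_matrix_inverse:
  fixes s t :: "'a::field"
  assumes "s \<noteq> 0"
  shows "parabolic_matrix s t ** parabolic_matrix (1 / s) (- t / s) = mat 1"
    "parabolic_matrix (1 / s) (- t / s) ** parabolic_matrix s t = mat 1"
  using assms by (simp_all add: parabolic_matrix_mult flip: parabolic_matrix_one)

lemma invertible_P_plus: "\<alpha> \<in> (P_plus :: ('a::linordered_field^2^2) set) \<Longrightarrow> invertible \<alpha>"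
  unfolding P_plus_iff invertible_def
  using parabolic_matrix_inverse by (metis less_irrefl)

lemma matrix_inv_mult:
  assumes "invertible M"
  shows "matrix_inv M ** M = mat 1" "M ** matrix_inv M = mat 1"
  using someI_ex[OF assms[unfolded invertible_def]] unfolding matrix_inv_def by auto

lemma matrix_inv_parabolic:
  fixes s t :: real
  assumes "0 < s"
  shows "matrix_inv (parabolic_matrix s t) = parabolic_matrix (1 / s) (- t / s)"
proof -
  have "invertible (parabolic_matrix s t)"
    using assms by (intro invertible_P_plus) (auto simp: P_plus_iff parabolic_matrix_eq_iff)
  from matrix_inv_mult(1)[OF this] show ?thesis
    using parabolic_matrix_inverse(1)[of s t] assms
    by (metis less_irrefl matrix_mul_assoc matrix_mul_lid matrix_mul_rid)
qed

section \<open>Commensurability as a condition on the relative matrix\<close>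

lemma mat_act_parabolic:
  "mat_act (parabolic_matrix s t) z = Complex (s * Re z - t * Im z) (Im z)"
  by (simp add: mat_act_def Let_def matrix_vector_mult_def sum_2 e1_def e2_def complex_eq_iff)

lemma Lambda0_iff: "z \<in> Lambda0 \<longleftrightarrow> Re z \<in> \<int> \<and> Im z \<in> \<int>"
proof
  assume "Re z \<in> \<int> \<and> Im z \<in> \<int>"
  then obtain m n where "Re z = of_int m" "Im z = of_int n" by (elim conjE Ints_cases)
  then have "z = of_int m * e1 + of_int (- n) * e2"
    by (simp add: e1_def e2_def complex_eq_iff)
  then show "z \<in> Lambda0" unfolding Lambda0_def by blast
qed (auto simp: Lambda0_def e1_def e2_def)

lemma zero_in_Lambda0 [simp]: "0 \<in> Lambda0"
  by (simp add: Lambda0_iff)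

definition rational_points :: "complex set" where
  "rational_points = {z. Re z \<in> \<rat> \<and> Im z \<in> \<rat>}"

lemma of_rat_mult_complex_real: "of_rat q * z = complex_of_real (of_rat q) * z"
proof -
  obtain k n where "0 < n" "q = of_int k / of_nat n" by (rule rat_fraction)
  then show ?thesis by (simp add: of_rat_divide)
qed

text \<open>
  The rational span is defined by rational multiples of single lattice points, so it is closed under
  sums only through common denominators.
\<close>

lemma rational_span_Lambda0: "rational_span Lambda0 = rational_points"
proof (intro equalityI subsetI)
  fix z assume "z \<in> rational_points"
  then obtain p q :: rat where pq: "Re z = of_rat p" "Im z = of_rat q"
    unfolding rational_points_def by (auto elim!: Rats_cases)
  obtain k l n where n: "0 < n" and k: "p = of_int k / of_nat n" "q = of_int l / of_nat n"
    by (rule rat_common_denominator)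
  have "z = of_rat (1 / of_nat n) * Complex (of_int k) (of_int l)"
    using n pq k by (simp add: of_rat_mult_complex_real complex_eq_iff of_rat_divide)
  moreover have "Complex (of_int k) (of_int l) \<in> Lambda0" by (simp add: Lambda0_iff)
  ultimately show "z \<in> rational_span Lambda0" unfolding rational_span_def by blast
next
  fix z assume "z \<in> rational_span Lambda0"
  then show "z \<in> rational_points"
    unfolding rational_span_def rational_points_def
    by (auto simp: Lambda0_iff of_rat_mult_complex_real intro!: Rats_mult dest: Ints_subset_Rats[THEN subsetD])
qed

lemma rational_span_mat_act: "rational_span (mat_act M ` L) = mat_act M ` rational_span L"
proof -
  have "of_rat q * mat_act M l = mat_act M (of_rat q * l)" for q l
    unfolding of_rat_mult_complex_real mat_act_scale ..
  then have "rational_span (mat_act M ` L) = {mat_act M (of_rat q * l) | q l. l \<in> L}"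
    unfolding rational_span_def by (metis (no_types, opaque_lifting) image_iff)
  then show ?thesis unfolding rational_span_def by blast
qed

lemma mat_act_diff: "mat_act M (x - y) = mat_act M x - mat_act M y"
  using mat_act_add[of M "x - y" y] by simp

lemma mat_act_inverse:
  assumes "invertible \<alpha>"
  shows "mat_act \<alpha> (mat_act (matrix_inv \<alpha>) x) = x" "mat_act (matrix_inv \<alpha>) (mat_act \<alpha> x) = x"
  by (simp_all add: mat_act_mult mat_act_one matrix_inv_mult[OF assms])

lemma carrier_Q2_mod_Z2: "t \<in> carrier Q2_mod_Z2 \<longleftrightarrow> (\<exists>a. t = {w. \<forall>i. (w - a) $ i \<in> \<int>})"
  by (auto simp: Q2_mod_Z2_def FactGroup_def RCOSETS_def Z2_coset) (auto simp: additive_group_def)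

text \<open>
  The enlarged cosets in the definition of commensurability are cosets of one and the same group, so
  their equality can be tested on a difference of representatives.
\<close>

lemma coset_plus_subgroup_sum:
  fixes L L' :: "'a::ab_group_add set"
  assumes "0 \<in> L" "\<And>x y. x \<in> L \<Longrightarrow> y \<in> L \<Longrightarrow> x + y \<in> L"
  shows "{y. y - u \<in> L} + (L + L') = {y. y - u \<in> L + L'}"
proof (intro equalityI subsetI)
  fix w assume "w \<in> {y. y - u \<in> L} + (L + L')"
  then obtain y l l' where w: "w = y + (l + l')" "y - u \<in> L" "l \<in> L" "l' \<in> L'"
    by (auto simp: set_plus_def)
  have "w - u = ((y - u) + l) + l'" using w by (simp add: algebra_simps)
  then show "w \<in> {y. y - u \<in> L + L'}"
    using set_plus_intro[OF assms(2)[OF w(2,3)] w(4)] by (simp only: mem_Collect_eq)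
next
  fix w assume "w \<in> {y. y - u \<in> L + L'}"
  then have "w - u \<in> L + L'" by simp
  moreover have "w = u + (w - u)" "u \<in> {y. y - u \<in> L}" using assms(1) by simp_all
  ultimately show "w \<in> {y. y - u \<in> L} + (L + L')" unfolding set_plus_def by blast
qed

lemma mat_act_image_Lambda0_add:
  "x \<in> mat_act M ` Lambda0 \<Longrightarrow> y \<in> mat_act M ` Lambda0 \<Longrightarrow> x + y \<in> mat_act M ` Lambda0"
  by (auto simp: Lambda0_add simp flip: mat_act_add)

lemma mat_act_zero [simp]: "mat_act M 0 = 0"
  using mat_act_scale[of M 0 0] by simp

lemma mat_act_image_Lambda0_minus: "x \<in> mat_act M ` Lambda0 \<Longrightarrow> - x \<in> mat_act M ` Lambda0"
proof -
  assume "x \<in> mat_act M ` Lambda0"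
  then obtain y where "y \<in> Lambda0" "x = mat_act M y" by blast
  then show ?thesis
    using mat_act_diff[of M 0 y] Lambda0_minus by (auto intro!: image_eqI[of _ _ "- y"])
qed

lemma coset_eq_iff:
  fixes u v :: "'a::ab_group_add"
  assumes "0 \<in> S" "\<And>x y. x \<in> S \<Longrightarrow> y \<in> S \<Longrightarrow> x + y \<in> S" "\<And>x. x \<in> S \<Longrightarrow> - x \<in> S"
  shows "{y. y - u \<in> S} = {y. y - v \<in> S} \<longleftrightarrow> u - v \<in> S"
proof
  assume "{y. y - u \<in> S} = {y. y - v \<in> S}"
  moreover have "u \<in> {y. y - u \<in> S}" using assms(1) by simp
  ultimately show "u - v \<in> S" by blast
next
  assume uv: "u - v \<in> S"
  have "y - u \<in> S \<longleftrightarrow> y - v \<in> S" for y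
    using assms(2)[OF _ uv, of "y - u"] assms(2)[OF _ assms(3)[OF uv], of "y - v"] by auto
  then show "{y. y - u \<in> S} = {y. y - v \<in> S}" by blast
qed

text \<open>
  All lattices and cosets are transported by \<open>\<alpha>2\<close>, which sends the second lattice to \<open>Lambda0\<close> and the first
  to \<open>\<gamma> Lambda0\<close>.  Equality of the two enlarged cosets becomes membership of a difference
  of representatives in the sum of the lattices.
\<close>

lemma commensurable_iff_relative_matrix:
  assumes inv: "invertible \<alpha>1" "invertible \<alpha>2"
  defines "\<gamma> \<equiv> \<alpha>2 ** matrix_inv \<alpha>1"
  shows "commensurable (Q_lattice_of \<rho>1 \<alpha>1) (Q_lattice_of \<rho>2 \<alpha>2) \<longleftrightarrow>
    mat_act \<gamma> ` rational_points = rational_points \<and>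
    (\<forall>v. mat_act \<gamma> (rho_rep \<rho>1 v) - rho_rep \<rho>2 v \<in> mat_act \<gamma> ` Lambda0 + Lambda0)"
proof -
  let ?M1 = "mat_act (matrix_inv \<alpha>1)" and ?M2 = "mat_act (matrix_inv \<alpha>2)"
  define L1 where "L1 = ?M1 ` Lambda0"
  define L2 where "L2 = ?M2 ` Lambda0"
  note i1 = mat_act_inverse[OF inv(1)] and i2 = mat_act_inverse[OF inv(2)]
  have \<gamma>: "mat_act \<gamma> z = mat_act \<alpha>2 (?M1 z)" for z
    by (simp add: \<gamma>_def mat_act_mult)
  have span: "rational_span L1 = rational_span L2 \<longleftrightarrow> mat_act \<gamma> ` rational_points = rational_points"
  proof -
    have "rational_span L1 = rational_span L2
        \<longleftrightarrow> mat_act \<alpha>2 ` (?M1 ` rational_points) = mat_act \<alpha>2 ` (?M2 ` rational_points)"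
      unfolding L1_def L2_def rational_span_mat_act rational_span_Lambda0
      using i2(2) by (metis injI inj_image_eq_iff)
    then show ?thesis by (simp add: image_image \<gamma> i2)
  qed
  have coset: "mat_act M ` {z. z - x \<in> Lambda0} = {y. y - mat_act M x \<in> mat_act M ` Lambda0}" for M x
  proof -
    have "y \<in> mat_act M ` {z. z - x \<in> Lambda0}" if "y - mat_act M x = mat_act M l" "l \<in> Lambda0" for y l
      using that by (intro image_eqI[of _ _ "x + l"]) (simp_all add: mat_act_add algebra_simps)
    then show ?thesis by (auto simp flip: mat_act_diff)
  qed
  have L: "0 \<in> L1" "0 \<in> L2" "\<And>x y. x \<in> L1 \<Longrightarrow> y \<in> L1 \<Longrightarrow> x + y \<in> L1"
      "\<And>x y. x \<in> L2 \<Longrightarrow> y \<in> L2 \<Longrightarrow> x + y \<in> L2"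
      "\<And>x. x \<in> L1 \<Longrightarrow> - x \<in> L1" "\<And>x. x \<in> L2 \<Longrightarrow> - x \<in> L2"
    unfolding L1_def L2_def
    by (auto intro: mat_act_image_Lambda0_add mat_act_image_Lambda0_minus image_eqI[of _ _ 0])
  have sum: "0 \<in> L1 + L2" "\<And>x y. x \<in> L1 + L2 \<Longrightarrow> y \<in> L1 + L2 \<Longrightarrow> x + y \<in> L1 + L2"
      "\<And>x. x \<in> L1 + L2 \<Longrightarrow> - x \<in> L1 + L2"
  proof -
    show "0 \<in> L1 + L2" using set_plus_intro[OF L(1,2)] by simp
  next
    fix x y assume "x \<in> L1 + L2" "y \<in> L1 + L2"
    then obtain a b c d where "x = a + b" "y = c + d" "a \<in> L1" "b \<in> L2" "c \<in> L1" "d \<in> L2"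
      by (elim set_plus_elim)
    then show "x + y \<in> L1 + L2"
      using set_plus_intro[OF L(3)[of a c] L(4)[of b d]] by (simp add: algebra_simps)
  next
    fix x assume "x \<in> L1 + L2"
    then obtain a b where "x = a + b" "a \<in> L1" "b \<in> L2" by (elim set_plus_elim)
    then show "- x \<in> L1 + L2" using set_plus_intro[OF L(5)[of a] L(6)[of b]] by simp
  qed
  have mem: "z \<in> L1 + L2 \<longleftrightarrow> mat_act \<alpha>2 z \<in> mat_act \<gamma> ` Lambda0 + Lambda0" for z
  proof
    assume "z \<in> L1 + L2"
    then obtain p q where "p \<in> Lambda0" "q \<in> Lambda0" "z = ?M1 p + ?M2 q"
      unfolding L1_def L2_def by (auto elim!: set_plus_elim)
    then show "mat_act \<alpha>2 z \<in> mat_act \<gamma> ` Lambda0 + Lambda0"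
      by (auto simp: mat_act_add i2 \<gamma> intro!: set_plus_intro)
  next
    assume "mat_act \<alpha>2 z \<in> mat_act \<gamma> ` Lambda0 + Lambda0"
    then obtain p q where pq: "p \<in> Lambda0" "q \<in> Lambda0" "mat_act \<alpha>2 z = mat_act \<gamma> p + q"
      by (auto elim!: set_plus_elim)
    have "z = ?M2 (mat_act \<alpha>2 z)" by (simp add: i2)
    also have "\<dots> = ?M1 p + ?M2 q" unfolding pq(3) by (simp add: mat_act_add i2 \<gamma>)
    finally show "z \<in> L1 + L2"
      using pq unfolding L1_def L2_def by (auto intro!: set_plus_intro)
  qed
  have phi: "(mat_act (matrix_inv \<alpha>1) ` rho_map \<rho>1 {w. \<forall>i. (w - v) $ i \<in> \<int>}) + (L1 + L2)
        = (mat_act (matrix_inv \<alpha>2) ` rho_map \<rho>2 {w. \<forall>i. (w - v) $ i \<in> \<int>}) + (L1 + L2)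
      \<longleftrightarrow> mat_act \<gamma> (rho_rep \<rho>1 v) - rho_rep \<rho>2 v \<in> mat_act \<gamma> ` Lambda0 + Lambda0" for v
  proof -
    have "(mat_act (matrix_inv \<alpha>1) ` rho_map \<rho>1 {w. \<forall>i. (w - v) $ i \<in> \<int>}) + (L1 + L2)
        = {y. y - ?M1 (rho_rep \<rho>1 v) \<in> L1 + L2}"
      unfolding rho_map_coset coset L1_def[symmetric]
      by (rule coset_plus_subgroup_sum) (fact L(1), fact L(3))
    moreover have "(mat_act (matrix_inv \<alpha>2) ` rho_map \<rho>2 {w. \<forall>i. (w - v) $ i \<in> \<int>}) + (L1 + L2)
        = {y. y - ?M2 (rho_rep \<rho>2 v) \<in> L1 + L2}"
      unfolding rho_map_coset coset L2_def[symmetric] add.commute[of L1 L2]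
      by (rule coset_plus_subgroup_sum) (fact L(2), fact L(4))
    ultimately show ?thesis
      using coset_eq_iff[OF sum, of "?M1 (rho_rep \<rho>1 v)" "?M2 (rho_rep \<rho>2 v)"]
      by (simp add: mem mat_act_diff i2 \<gamma>)
  qed
  have all_carrier: "(\<forall>t\<in>carrier Q2_mod_Z2. P t) \<longleftrightarrow> (\<forall>v. P {w. \<forall>i. (w - v) $ i \<in> \<int>})" for P
    unfolding Ball_def carrier_Q2_mod_Z2 by blast
  have "commensurable (Q_lattice_of \<rho>1 \<alpha>1) (Q_lattice_of \<rho>2 \<alpha>2) \<longleftrightarrow>
      rational_span L1 = rational_span L2 \<and>
      (\<forall>t \<in> carrier Q2_mod_Z2. (mat_act (matrix_inv \<alpha>1) ` rho_map \<rho>1 t) + (L1 + L2)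
        = (mat_act (matrix_inv \<alpha>2) ` rho_map \<rho>2 t) + (L1 + L2))"
    by (simp add: commensurable_def Q_lattice_of_def L1_def L2_def)
  also have "\<dots> \<longleftrightarrow> rational_span L1 = rational_span L2 \<and>
      (\<forall>v. mat_act \<gamma> (rho_rep \<rho>1 v) - rho_rep \<rho>2 v \<in> mat_act \<gamma> ` Lambda0 + Lambda0)"
    unfolding phi[symmetric] all_carrier ..
  finally show ?thesis unfolding span .
qed

text \<open>
  The images of \<open>1\<close> and \<open>\<i>\<close> display the entries of the matrix.
\<close>

lemma parabolic_preserves_rational_points_iff:
  assumes c: "0 < c"
  shows "mat_act (parabolic_matrix c d) ` rational_points = rational_points \<longleftrightarrow> c \<in> \<rat> \<and> d \<in> \<rat>"
proof
  assume *: "mat_act (parabolic_matrix c d) ` rational_points = rational_points"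
  have "1 \<in> rational_points" "\<i> \<in> rational_points" by (simp_all add: rational_points_def)
  then have "mat_act (parabolic_matrix c d) 1 \<in> rational_points"
      "mat_act (parabolic_matrix c d) \<i> \<in> rational_points"
    using * by blast+
  then show "c \<in> \<rat> \<and> d \<in> \<rat>"
    by (simp add: mat_act_parabolic rational_points_def)
next
  assume cd: "c \<in> \<rat> \<and> d \<in> \<rat>"
  show "mat_act (parabolic_matrix c d) ` rational_points = rational_points"
  proof (intro equalityI subsetI)
    fix z assume "z \<in> rational_points"
    then have "Complex ((Re z + d * Im z) / c) (Im z) \<in> rational_points"
      using cd by (simp add: rational_points_def)
    moreover have "z = mat_act (parabolic_matrix c d) (Complex ((Re z + d * Im z) / c) (Im z))"
      using c by (simp add: mat_act_parabolic complex_eq_iff)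
    ultimately show "z \<in> mat_act (parabolic_matrix c d) ` rational_points" by blast
  qed (use cd in \<open>auto simp: mat_act_parabolic rational_points_def\<close>)
qed

lemma real_point_in_lattice_sum_iff:
  "Complex (of_rat u) 0 \<in> mat_act (parabolic_matrix (of_rat c) (of_rat d)) ` Lambda0 + Lambda0
    \<longleftrightarrow> u \<in> fractional_ideal c d"
proof
  assume "Complex (of_rat u) 0 \<in> mat_act (parabolic_matrix (of_rat c) (of_rat d)) ` Lambda0 + Lambda0"
  then obtain p q where p: "p \<in> Lambda0" and q: "q \<in> Lambda0"
    and u: "Complex (of_rat u) 0 = mat_act (parabolic_matrix (of_rat c) (of_rat d)) p + q"
    by (auto elim!: set_plus_elim)
  obtain m n where mn: "Re p = of_int m" "Im p = of_int n"
    using p unfolding Lambda0_iff by (elim conjE Ints_cases)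
  obtain k where k: "Re q = of_int k" using q unfolding Lambda0_iff by (elim conjE Ints_cases)
  have "of_rat u = of_rat c * Re p - of_rat d * Im p + Re q"
    using arg_cong[OF u, of Re] by (simp add: mat_act_parabolic)
  also have "\<dots> = of_rat (c * of_int m + d * of_int (- n) + of_int k)"
    unfolding mn k by (simp add: of_rat_add of_rat_mult of_rat_minus of_rat_diff)
  finally have "u = c * of_int m + d * of_int (- n) + of_int k" by (simp only: of_rat_eq_iff)
  then show "u \<in> fractional_ideal c d" by (simp only: fractional_idealI Ints_of_int)
next
  assume "u \<in> fractional_ideal c d"
  then obtain m n k where u: "u = c * of_int m + d * of_int n + of_int k"
    by (rule fractional_idealE)
  have "Complex (of_rat u) 0
      = mat_act (parabolic_matrix (of_rat c) (of_rat d)) (Complex (of_int m) (- of_int n))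
        + Complex (of_int k) (of_int n)"
    unfolding u by (simp add: mat_act_parabolic complex_eq_iff of_rat_add of_rat_mult)
  then show "Complex (of_rat u) 0
      \<in> mat_act (parabolic_matrix (of_rat c) (of_rat d)) ` Lambda0 + Lambda0"
    by (auto simp: Lambda0_iff intro!: set_plus_intro)
qed

lemma rho_rep_parabolic:
  "rho_rep (parabolic_matrix a b) v =
    Complex (of_rat (zhat_act a (v $ 1) + zhat_act b (v $ 2))) (- of_rat (zhat_act 1 (v $ 2)))"
proof -
  have "(of_rat r :: complex) = of_real (of_rat r)" for r
    using of_rat_mult_complex_real[of r 1] by simp
  then show ?thesis
    by (simp add: rho_rep_def e1_def e2_def complex_eq_iff)
qed

text \<open>
  A torsion point has two coordinates, and the conditions for the two columns separate: \<open>y = 0\<close> gives the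
  equation for the first entry and \<open>x = 0\<close> the one for the second.  In the first equation \<open>d\<close> is
  multiplied by the profinite integer \<open>0\<close>, so that both equations refer to the same ideal.
\<close>

lemma adelic_matrix_equation_iff_pointwise:
  "map_matrix adele_of_zhat (parabolic_matrix a2 b2) =
     map_matrix adele_of_rat (parabolic_matrix c d) ** map_matrix adele_of_zhat (parabolic_matrix a1 b1)
   \<longleftrightarrow> (\<forall>x y. (c * (zhat_act a1 x + zhat_act b1 y) + d * zhat_act 1 y) - (zhat_act a2 x + zhat_act b2 y)
        \<in> fractional_ideal c d)" (is "?l \<longleftrightarrow> (\<forall>x y. ?P x y)")
proof -
  have "?l \<longleftrightarrow> adele_of_zhat a2 = adele_of_rat c * adele_of_zhat a1 + adele_of_rat d * adele_of_zhat 0 \<and>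
      adele_of_zhat b2 = adele_of_rat c * adele_of_zhat b1 + adele_of_rat d * adele_of_zhat 1"
    by (simp add: map_matrix_parabolic parabolic_matrix_mult parabolic_matrix_eq_iff)
  also have "\<dots> \<longleftrightarrow> (\<forall>x. ?P x 0) \<and> (\<forall>y. ?P 0 y)"
    unfolding adelic_combination_iff_pointwise by simp
  also have "\<dots> \<longleftrightarrow> (\<forall>x y. ?P x y)"
  proof (intro iffI conjI allI)
    fix x y assume "(\<forall>x. ?P x 0) \<and> (\<forall>y. ?P 0 y)"
    then have "?P x 0" "?P 0 y" by blast+
    from fractional_ideal_add[OF this] show "?P x y" by (simp add: algebra_simps)
  qed blast+
  finally show ?thesis .
qed

text \<open>
  Since \<open>\<alpha>1\<close> is invertible, \<open>\<alpha>2 = g \<alpha>1\<close> holds only for \<open>g = \<alpha>2 \<alpha>1\<^sup>-\<^sup>1\<close>.  Thus the existence of a rational \<open>g\<close>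
  amounts to rationality of the entries \<open>c\<close>, \<open>d\<close> of this matrix together with the adelic equation, and
  these are the two conditions for commensurability.
\<close>

lemma parabolic_commensurable_iff:
  fixes \<rho>1 \<rho>2 :: "zhat^2^2" and \<alpha>1 \<alpha>2 :: "real^2^2"
  assumes \<rho>: "\<rho>1 \<in> P_bar" "\<rho>2 \<in> P_bar" and \<alpha>: "\<alpha>1 \<in> P_plus" "\<alpha>2 \<in> P_plus"
  shows "commensurable (Q_lattice_of \<rho>1 \<alpha>1) (Q_lattice_of \<rho>2 \<alpha>2) \<longleftrightarrow>
      (\<exists>g\<in>(P_plus :: (rat^2^2) set).
         map_matrix adele_of_zhat \<rho>2 = map_matrix adele_of_rat g ** map_matrix adele_of_zhat \<rho>1 \<and>
         \<alpha>2 = map_matrix of_rat g ** \<alpha>1)"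
proof -
  obtain a1 b1 a2 b2 where r: "\<rho>1 = parabolic_matrix a1 b1" "\<rho>2 = parabolic_matrix a2 b2"
    using \<rho> unfolding P_bar_def by blast
  obtain s1 t1 s2 t2 where s: "0 < s1" "0 < s2" and
    al: "\<alpha>1 = parabolic_matrix s1 t1" "\<alpha>2 = parabolic_matrix s2 t2"
    using \<alpha> unfolding P_plus_iff by blast
  define c d where "c = s2 / s1" and "d = t2 - s2 * t1 / s1"
  have c: "0 < c" using s by (simp add: c_def)
  have inv: "matrix_inv \<alpha>1 = parabolic_matrix (1 / s1) (- t1 / s1)"
    unfolding al by (rule matrix_inv_parabolic[OF s(1)])
  have \<gamma>: "\<alpha>2 ** matrix_inv \<alpha>1 = parabolic_matrix c d"
    unfolding inv unfolding al by (simp add: parabolic_matrix_mult c_def d_def)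
  have \<alpha>2_iff: "\<alpha>2 = g ** \<alpha>1 \<longleftrightarrow> g = parabolic_matrix c d" for g
  proof -
    have 1: "\<alpha>1 ** matrix_inv \<alpha>1 = mat 1" "matrix_inv \<alpha>1 ** \<alpha>1 = mat 1"
      using matrix_inv_mult[OF invertible_P_plus[OF \<alpha>(1)]] by blast+
    show ?thesis unfolding \<gamma>[symmetric]
      using 1 by (metis matrix_mul_assoc matrix_mul_rid)
  qed
  have point: "mat_act (parabolic_matrix (of_rat c') (of_rat d')) (rho_rep \<rho>1 v) - rho_rep \<rho>2 v
    = Complex (of_rat ((c' * (zhat_act a1 (v $ 1) + zhat_act b1 (v $ 2)) + d' * zhat_act 1 (v $ 2))
        - (zhat_act a2 (v $ 1) + zhat_act b2 (v $ 2)))) 0" for c' d' v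
    unfolding r rho_rep_parabolic mat_act_parabolic
    by (simp add: complex_eq_iff of_rat_add of_rat_mult of_rat_diff algebra_simps)
  have all_vec: "(\<forall>v::rat^2. P (v $ 1) (v $ 2)) \<longleftrightarrow> (\<forall>x y. P x y)" for P
  proof (intro iffI allI)
    fix x y assume "\<forall>v::rat^2. P (v $ 1) (v $ 2)"
    from this[rule_format, of "vector [x, y]"] show "P x y" by simp
  qed blast
  have pointwise: "(\<forall>v. mat_act (parabolic_matrix (of_rat c') (of_rat d')) (rho_rep \<rho>1 v) - rho_rep \<rho>2 v
        \<in> mat_act (parabolic_matrix (of_rat c') (of_rat d')) ` Lambda0 + Lambda0) \<longleftrightarrow>
      map_matrix adele_of_zhat \<rho>2
        = map_matrix adele_of_rat (parabolic_matrix c' d') ** map_matrix adele_of_zhat \<rho>1" for c' d'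
    unfolding point real_point_in_lattice_sum_iff unfolding r adelic_matrix_equation_iff_pointwise
    by (rule all_vec[where P = "\<lambda>x y. c' * (zhat_act a1 x + zhat_act b1 y) + d' * zhat_act 1 y
        - (zhat_act a2 x + zhat_act b2 y) \<in> fractional_ideal c' d'"])
  have "commensurable (Q_lattice_of \<rho>1 \<alpha>1) (Q_lattice_of \<rho>2 \<alpha>2) \<longleftrightarrow> c \<in> \<rat> \<and> d \<in> \<rat> \<and>
      (\<forall>v. mat_act (parabolic_matrix c d) (rho_rep \<rho>1 v) - rho_rep \<rho>2 v
        \<in> mat_act (parabolic_matrix c d) ` Lambda0 + Lambda0)"
    using commensurable_iff_relative_matrix[OF \<alpha>[THEN invertible_P_plus], of \<rho>1 \<rho>2]
    unfolding \<gamma> parabolic_preserves_rational_points_iff[OF c] by simp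
  also have "\<dots> \<longleftrightarrow> (\<exists>c' d'. c = of_rat c' \<and> d = of_rat d' \<and>
      (\<forall>v. mat_act (parabolic_matrix (of_rat c') (of_rat d')) (rho_rep \<rho>1 v) - rho_rep \<rho>2 v
        \<in> mat_act (parabolic_matrix (of_rat c') (of_rat d')) ` Lambda0 + Lambda0))"
    by (auto elim!: Rats_cases)
  also have "\<dots> \<longleftrightarrow> (\<exists>c' d'. c = of_rat c' \<and> d = of_rat d' \<and>
      map_matrix adele_of_zhat \<rho>2
        = map_matrix adele_of_rat (parabolic_matrix c' d') ** map_matrix adele_of_zhat \<rho>1)"
    unfolding pointwise ..
  also have "\<dots> \<longleftrightarrow> (\<exists>g\<in>(P_plus :: (rat^2^2) set).
         map_matrix adele_of_zhat \<rho>2 = map_matrix adele_of_rat g ** map_matrix adele_of_zhat \<rho>1 \<and>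
         \<alpha>2 = map_matrix of_rat g ** \<alpha>1)"
    using c unfolding \<alpha>2_iff Bex_def P_plus_iff
    by (fastforce simp: map_matrix_parabolic[of of_rat] parabolic_matrix_eq_iff)
  finally show ?thesis .
qed

section \<open>Topology of the finite adeles\<close>

text \<open>
  A set is open if it contains such a coset around each of its points.  Each point of a coset of the
  subgroup of multiples of \<open>n\<close> has the same coset around it.
\<close>

lemma open_adele_coset:
  assumes "0 < n"
  shows "open (range (\<lambda>z. a + adele_of_zhat (of_nat n * z)))"
  unfolding open_finite_adele_def
proof (intro ballI exI conjI allI)
  fix x z assume "x \<in> range (\<lambda>z. a + adele_of_zhat (of_nat n * z))"
  then obtain w where "x = a + adele_of_zhat (of_nat n * w)" by blast
  then have "x + adele_of_zhat (of_nat n * z) = a + adele_of_zhat (of_nat n * (w + z))"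
    by (simp add: distrib_left adele_of_zhat_add add.assoc)
  then show "x + adele_of_zhat (of_nat n * z) \<in> range (\<lambda>z. a + adele_of_zhat (of_nat n * z))"
    by blast
qed (rule assms)

instance finite_adele :: topological_comm_monoid_add
proof
  fix a b :: finite_adele
  show "((\<lambda>x. fst x + snd x) \<longlongrightarrow> a + b) (nhds a \<times>\<^sub>F nhds b)"
  proof (rule topological_tendstoI)
    fix U :: "finite_adele set" assume "open U" "a + b \<in> U"
    then obtain n where n: "0 < n" "\<And>z. a + b + adele_of_zhat (of_nat n * z) \<in> U"
      unfolding open_finite_adele_def by blast
    let ?N = "\<lambda>c. range (\<lambda>z. c + adele_of_zhat (of_nat n * z))"
    have N: "\<forall>\<^sub>F x in nhds c. x \<in> ?N c" for c
      using open_adele_coset[OF n(1)]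
      by (rule eventually_nhds_in_open) (auto intro: image_eqI[of _ _ 0])
    have "x + y \<in> U" if xy: "x \<in> ?N a" "y \<in> ?N b" for x y
    proof -
      obtain u v where "x = a + adele_of_zhat (of_nat n * u)" "y = b + adele_of_zhat (of_nat n * v)"
        using xy by (elim rangeE)
      then have "x + y = a + b + adele_of_zhat (of_nat n * (u + v))"
        by (simp add: distrib_left adele_of_zhat_add algebra_simps)
      then show ?thesis using n(2) by simp
    qed
    then show "\<forall>\<^sub>F x in nhds a \<times>\<^sub>F nhds b. fst x + snd x \<in> U"
      unfolding eventually_prod_filter using N[of a] N[of b]
      by (intro exI[of _ "\<lambda>x. x \<in> ?N a"] exI[of _ "\<lambda>x. x \<in> ?N b"]) simp
  qed
qed

lemma continuous_on_adele_of_rat_mult [continuous_intros]: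
  fixes f :: "'a::topological_space \<Rightarrow> finite_adele"
  assumes "continuous_on S f"
  shows "continuous_on S (\<lambda>x. adele_of_rat c * f x)"
proof -
  obtain k m where m: "0 < m" and c: "c = of_int k / of_nat m" by (rule rat_fraction)
  have "open ((\<lambda>x. adele_of_rat c * x) -` U)" if U: "open U" for U
    unfolding open_finite_adele_def
  proof
    fix x assume "x \<in> (\<lambda>x. adele_of_rat c * x) -` U"
    then obtain n where n: "0 < n" "\<And>z. adele_of_rat c * x + adele_of_zhat (of_nat n * z) \<in> U"
      using U unfolding open_finite_adele_def by blast
    \<comment> \<open>The factor \<open>m\<close> absorbs the denominator of \<open>c\<close>.\<close>
    have "adele_of_rat c * adele_of_zhat (of_nat (m * n) * z) = adele_of_zhat (of_nat n * (of_int k * z))" for z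
      using m unfolding c
      by (simp add: adele_of_rat_fraction adele_of_zhat_def adele_frac_mult adele_frac_eq_iff algebra_simps)
    then have "x + adele_of_zhat (of_nat (m * n) * z) \<in> (\<lambda>x. adele_of_rat c * x) -` U" for z
      using n(2)[of "of_int k * z"] by (simp only: vimage_eq distrib_left)
    then show "\<exists>n>0. \<forall>z. x + adele_of_zhat (of_nat n * z) \<in> (\<lambda>x. adele_of_rat c * x) -` U"
      using m n(1) by (intro exI[of _ "m * n"]) simp
  qed
  then have "continuous_on UNIV (\<lambda>x. adele_of_rat c * x)"
    by (auto simp: continuous_on_open_vimage)
  then show ?thesis using continuous_on_compose2[OF _ assms] by blast
qed

text \<open>
  Together with the following lemmas: the profinite integers, with their profinite topology, are an
  open subspace of the adeles.
\<close>

lemma open_image_adele_of_zhat: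
  assumes "open U"
  shows "open (adele_of_zhat ` U)"
  unfolding open_finite_adele_def
proof
  fix a assume "a \<in> adele_of_zhat ` U"
  then obtain x where x: "a = adele_of_zhat x" "x \<in> U" by blast
  obtain n where n: "0 < n" "\<And>y. residue y n = residue x n \<Longrightarrow> y \<in> U"
    using assms x(2) unfolding open_zhat_def by blast
  have "residue (x + of_nat n * z) n = residue x n" for z
    by (simp add: plus_zhat.rep_eq)
  then have "a + adele_of_zhat (of_nat n * z) \<in> adele_of_zhat ` U" for z
    unfolding x(1) adele_of_zhat_add[symmetric] by (intro imageI n(2))
  then show "\<exists>n>0. \<forall>z. a + adele_of_zhat (of_nat n * z) \<in> adele_of_zhat ` U"
    using n(1) by blast
qed

lemma continuous_on_adele_of_zhat: "continuous_on S adele_of_zhat"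
proof -
  have "open (adele_of_zhat -` U)" if U: "open U" for U
    unfolding open_zhat_def
  proof
    fix x assume "x \<in> adele_of_zhat -` U"
    then obtain n where n: "0 < n" "\<And>z. adele_of_zhat x + adele_of_zhat (of_nat n * z) \<in> U"
      using U unfolding open_finite_adele_def by blast
    have "y \<in> adele_of_zhat -` U" if y: "residue y n = residue x n" for y
    proof -
      have "residue (y - x) n = 0"
        using y by (simp only: diff_conv_add_uminus plus_zhat.rep_eq uminus_zhat.rep_eq mod_add_right_eq) simp
      then obtain z where "y - x = of_nat n * z" using residue_eq_0_imp_multiple[OF n(1)] by blast
      then have "y = x + of_nat n * z" by (simp add: algebra_simps)
      then show ?thesis using n(2)[of z] by (simp add: adele_of_zhat_add)
    qed
    then show "\<exists>n>0. \<forall>y. residue y n = residue x n \<longrightarrow> y \<in> adele_of_zhat -` U"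
      using n(1) by blast
  qed
  then have "continuous_on UNIV adele_of_zhat" by (auto simp: continuous_on_open_vimage)
  then show ?thesis by (rule continuous_on_subset) simp
qed

lemma continuous_on_inv_adele_of_zhat: "continuous_on (range adele_of_zhat) (inv_into UNIV adele_of_zhat)"
  unfolding continuous_on_open_vimage[OF open_image_adele_of_zhat[OF open_UNIV]]
proof (intro allI impI)
  fix U :: "zhat set" assume "open U"
  moreover have "inv_into UNIV adele_of_zhat -` U \<inter> range adele_of_zhat = adele_of_zhat ` U"
    using inv_f_f[OF inj_adele_of_zhat] by (auto simp: image_iff)
  ultimately show "open (inv_into UNIV adele_of_zhat -` U \<inter> range adele_of_zhat)"
    using open_image_adele_of_zhat by simp
qed

section \<open>Integral pairs inside adelic pairs\<close>

lemma continuous_on_map_matrix: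
  fixes f :: "'a::topological_space \<Rightarrow> 'b::topological_space" and S :: "('a^'n::finite^'m::finite) set"
  assumes "continuous_on D f" "\<And>M i j. M \<in> S \<Longrightarrow> M $ i $ j \<in> D"
  shows "continuous_on S (map_matrix f)"
  unfolding map_matrix_def
  by (intro continuous_on_vec_lambda continuous_on_compose2[OF assms(1)] continuous_on_component
      continuous_on_id) (use assms(2) in auto)

definition adelic_pair_of_integral :: "(zhat^2^2) \<times> (real^2^2) \<Rightarrow> adelic_pair" where
  "adelic_pair_of_integral = map_prod (map_matrix adele_of_zhat) id"

lemma continuous_on_adelic_pair_of_integral: "continuous_on S adelic_pair_of_integral"
proof -
  have cont: "continuous_on UNIV (map_matrix adele_of_zhat)"
    by (rule continuous_on_map_matrix[OF continuous_on_adele_of_zhat[of UNIV]]) simp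
  show ?thesis
    unfolding adelic_pair_of_integral_def map_prod_def case_prod_beta id_def
    by (intro continuous_on_Pair continuous_on_snd continuous_on_id
        continuous_on_compose2[OF cont continuous_on_fst[OF continuous_on_id]]) auto
qed

lemma map_matrix_inv_adele_of_zhat [simp]:
  "map_matrix (inv_into UNIV adele_of_zhat) (map_matrix adele_of_zhat M) = M"
  by (simp add: vec_eq_iff inv_f_f[OF inj_adele_of_zhat])

text \<open>
  The image of the whole space is the set of pairs with integral entries, a finite intersection of
  open conditions, and on it the inverse map is continuous.
\<close>

lemma open_image_adelic_pair_of_integral:
  assumes "open U"
  shows "open (adelic_pair_of_integral ` U)"
proof -
  define W where "W = {M :: finite_adele^2^2. \<forall>i j. M $ i $ j \<in> range adele_of_zhat}"
  have "W = (\<Inter>i. \<Inter>j. (\<lambda>M. M $ i $ j) -` range adele_of_zhat)"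
    unfolding W_def by blast
  then have W: "open W"
    by (simp only:) (intro open_INT finite ballI open_vimage open_image_adele_of_zhat open_UNIV
        continuous_on_component continuous_on_id)
  have cont: "continuous_on W (map_matrix (inv_into UNIV adele_of_zhat))"
    by (rule continuous_on_map_matrix[OF continuous_on_inv_adele_of_zhat]) (auto simp: W_def)
  have "continuous_on (W \<times> UNIV) (\<lambda>p. (map_matrix (inv_into UNIV adele_of_zhat) (fst p), snd p :: real^2^2))"
    by (intro continuous_on_Pair continuous_on_snd continuous_on_id
        continuous_on_compose2[OF cont continuous_on_fst[OF continuous_on_id]]) auto
  then have "open ((\<lambda>p. (map_matrix (inv_into UNIV adele_of_zhat) (fst p), snd p)) -` U \<inter> W \<times> UNIV)"
    using continuous_on_open_vimage[OF open_Times[OF W open_UNIV]] assms by blast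
  also have "(\<lambda>p. (map_matrix (inv_into UNIV adele_of_zhat) (fst p), snd p)) -` U \<inter> W \<times> UNIV
      = adelic_pair_of_integral ` U"
  proof (intro equalityI subsetI)
    fix p assume p: "p \<in> (\<lambda>p. (map_matrix (inv_into UNIV adele_of_zhat) (fst p), snd p)) -` U \<inter> W \<times> UNIV"
    then have "map_matrix adele_of_zhat (map_matrix (inv_into UNIV adele_of_zhat) (fst p)) = fst p"
      by (auto simp: vec_eq_iff W_def f_inv_into_f)
    then have "p = adelic_pair_of_integral (map_matrix (inv_into UNIV adele_of_zhat) (fst p), snd p)"
      by (simp add: adelic_pair_of_integral_def)
    then show "p \<in> adelic_pair_of_integral ` U" using p by blast
  qed (auto simp: adelic_pair_of_integral_def W_def)
  finally show ?thesis .
qed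

lemma P_bar_map_adele_of_zhat_iff: "map_matrix adele_of_zhat \<rho> \<in> P_bar \<longleftrightarrow> \<rho> \<in> P_bar"
proof
  assume "map_matrix adele_of_zhat \<rho> \<in> P_bar"
  then obtain a b where "map_matrix adele_of_zhat \<rho> = parabolic_matrix a b"
    unfolding P_bar_def by blast
  then have "map_matrix adele_of_zhat \<rho> $ 2 $ 1 = 0" "map_matrix adele_of_zhat \<rho> $ 2 $ 2 = 1"
    by simp_all
  then have "adele_of_zhat (\<rho> $ 2 $ 1) = adele_of_zhat 0" "adele_of_zhat (\<rho> $ 2 $ 2) = adele_of_zhat 1"
    by simp_all
  then have "\<rho> $ 2 $ 1 = 0" "\<rho> $ 2 $ 2 = 1"
    by (simp_all only: inj_eq[OF inj_adele_of_zhat])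
  then have "\<rho> = parabolic_matrix (\<rho> $ 1 $ 1) (\<rho> $ 1 $ 2)"
    by (simp add: vec_eq_iff forall_2)
  then show "\<rho> \<in> P_bar" unfolding P_bar_def by blast
qed (auto simp: P_bar_def map_matrix_parabolic parabolic_matrix_eq_iff)

lemma open_map_adelic_pair_of_integral:
  "open_map (top_of_set (P_bar \<times> P_plus)) (top_of_set (P_bar \<times> P_plus)) adelic_pair_of_integral"
  unfolding open_map_def
proof (intro allI impI)
  fix V assume "openin (top_of_set (P_bar \<times> P_plus)) (V :: ((zhat^2^2) \<times> (real^2^2)) set)"
  then obtain U where U: "open U" "V = P_bar \<times> P_plus \<inter> U" by (auto simp: openin_open)
  have "adelic_pair_of_integral ` V = P_bar \<times> P_plus \<inter> adelic_pair_of_integral ` U"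
    unfolding U(2) by (auto simp: adelic_pair_of_integral_def P_bar_map_adele_of_zhat_iff)
  then show "openin (top_of_set (P_bar \<times> P_plus)) (adelic_pair_of_integral ` V)"
    using open_image_adelic_pair_of_integral[OF U(1)] by (auto simp: openin_open)
qed

section \<open>The action on adelic pairs\<close>

lemma map_matrix_mult:
  assumes "\<And>x y. f (x + y) = f x + f y" "\<And>x y. f (x * y) = f x * f y"
  shows "map_matrix f (M ** N) = map_matrix f M ** map_matrix f (N :: 'a::semiring_1^2^2)"
  by (simp add: vec_eq_iff matrix_matrix_mult_def sum_2 assms)

lemma map_matrix_one: "f 0 = 0 \<Longrightarrow> f 1 = 1 \<Longrightarrow> map_matrix f (mat 1) = mat 1"
  by (simp add: vec_eq_iff mat_def)

lemma P_plus_Q_act_mult: "P_plus_Q_act (g ** g') x = P_plus_Q_act g (P_plus_Q_act g' x)"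
  unfolding P_plus_Q_act_def
  by (simp add: case_prod_beta matrix_mul_assoc of_rat_add of_rat_mult
      map_matrix_mult[of adele_of_rat, OF adele_of_rat_add adele_of_rat_mult] map_matrix_mult[of of_rat])

lemma P_plus_Q_act_one: "P_plus_Q_act (mat 1) x = x"
  by (simp add: P_plus_Q_act_def case_prod_beta map_matrix_one)

lemma P_plus_inverse:
  assumes "(g :: 'a::linordered_field^2^2) \<in> P_plus"
  obtains h where "h \<in> P_plus" "h ** g = mat 1"
proof -
  obtain a b where "0 < a" "g = parabolic_matrix a b" using assms unfolding P_plus_iff by blast
  then show ?thesis
    using parabolic_matrix_inverse[of a b]
    by (intro that[of "parabolic_matrix (1 / a) (- b / a)"]) (auto simp: P_plus_iff parabolic_matrix_eq_iff)
qed

lemma P_plus_mult: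
  "g \<in> P_plus \<Longrightarrow> h \<in> P_plus \<Longrightarrow> g ** h \<in> (P_plus :: ('a::linordered_field^2^2) set)"
  unfolding P_plus_iff by (auto simp: parabolic_matrix_mult parabolic_matrix_eq_iff)

lemma mat_1_P_plus: "mat 1 \<in> (P_plus :: ('a::linordered_field^2^2) set)"
  unfolding P_plus_iff by (auto simp: parabolic_matrix_eq_iff simp flip: parabolic_matrix_one)

lemma P_plus_Q_act_closed:
  assumes "g \<in> P_plus" "x \<in> P_bar \<times> P_plus"
  shows "P_plus_Q_act g x \<in> P_bar \<times> P_plus"
proof -
  obtain a b where g: "0 < a" "g = parabolic_matrix a b" using assms(1) unfolding P_plus_iff by blast
  have "map_matrix adele_of_rat g ** fst x \<in> P_bar"
    using assms(2) unfolding g P_bar_def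
    by (auto simp: map_matrix_parabolic parabolic_matrix_mult parabolic_matrix_eq_iff)
  moreover have "map_matrix of_rat g \<in> (P_plus :: (real^2^2) set)"
    using g unfolding P_plus_iff by (auto simp: map_matrix_parabolic parabolic_matrix_eq_iff)
  ultimately show ?thesis
    using assms(2) by (auto simp: P_plus_Q_act_def intro: P_plus_mult)
qed

lemma P_plus_Q_orbit_eq_iff:
  "P_plus_Q_orbit x = P_plus_Q_orbit y \<longleftrightarrow> (\<exists>g\<in>P_plus. y = P_plus_Q_act g x)"
proof
  assume "P_plus_Q_orbit x = P_plus_Q_orbit y"
  moreover have "y \<in> P_plus_Q_orbit y"
    unfolding P_plus_Q_orbit_def using P_plus_Q_act_one[of y] mat_1_P_plus by force
  ultimately show "\<exists>g\<in>P_plus. y = P_plus_Q_act g x"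
    unfolding P_plus_Q_orbit_def by blast
next
  have sub: "P_plus_Q_orbit (P_plus_Q_act g x) \<subseteq> P_plus_Q_orbit x" if "g \<in> P_plus" for g x
    unfolding P_plus_Q_orbit_def using P_plus_mult that by (auto simp flip: P_plus_Q_act_mult)
  assume "\<exists>g\<in>P_plus. y = P_plus_Q_act g x"
  then obtain g where g: "g \<in> P_plus" "y = P_plus_Q_act g x" by blast
  obtain h where h: "h \<in> P_plus" "h ** g = mat 1" using P_plus_inverse[OF g(1)] by blast
  have "P_plus_Q_act h y = x" unfolding g(2) P_plus_Q_act_mult[symmetric] h(2) P_plus_Q_act_one ..
  then show "P_plus_Q_orbit x = P_plus_Q_orbit y"
    using sub[OF g(1), of x] sub[OF h(1), of y] g(2) by simp
qed

lemma continuous_on_P_plus_Q_act: "continuous_on S (P_plus_Q_act g)"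
  unfolding P_plus_Q_act_def case_prod_beta matrix_matrix_mult_def sum_2 nth_map_matrix
  by (intro continuous_intros)

text \<open>
  The saturation of an open set \<open>V\<close> is the union of the preimages of \<open>V\<close> under all group elements, and
  these are open since the group acts by continuous maps.
\<close>

lemma open_map_P_plus_Q_orbit:
  "open_map (top_of_set (P_bar \<times> P_plus)) adelic_quotient P_plus_Q_orbit"
  unfolding open_map_def
proof (intro allI impI)
  let ?Y = "P_bar \<times> P_plus :: adelic_pair set"
  fix V assume V: "openin (top_of_set ?Y) V"
  have VY: "V \<subseteq> ?Y" using V openin_imp_subset by blast
  have "{x \<in> ?Y. P_plus_Q_orbit x \<in> P_plus_Q_orbit ` V}
      = (\<Union>g\<in>P_plus. ?Y \<inter> P_plus_Q_act g -` V)"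
    using VY by (auto simp: P_plus_Q_orbit_eq_iff image_iff)
  moreover have preimage: "openin (top_of_set ?Y) (?Y \<inter> P_plus_Q_act g -` V)" if "g \<in> P_plus" for g
    using P_plus_Q_act_closed[OF that]
    by (intro continuous_openin_preimage[OF continuous_on_P_plus_Q_act _ V]) blast
  have "openin (top_of_set ?Y) (\<Union>g\<in>P_plus. ?Y \<inter> P_plus_Q_act g -` V)"
    by (intro openin_Union) (elim imageE, simp only: preimage)
  ultimately have "openin (top_of_set ?Y) {x \<in> ?Y. P_plus_Q_orbit x \<in> P_plus_Q_orbit ` V}"
    by (simp only:)
  then show "openin adelic_quotient (P_plus_Q_orbit ` V)"
    unfolding adelic_quotient_def openin_quotient_topology using VY by auto
qed

text \<open>
  Multiplication by \<open>diag(N, 1)\<close> scales the whole top row of an adelic matrix by \<open>N\<close> and keeps the bottom row,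
  so a common denominator of the two entries makes the matrix integral.
\<close>

lemma integral_representative:
  assumes "x \<in> (P_bar \<times> P_plus :: adelic_pair set)"
  obtains y where "y \<in> P_bar \<times> P_plus" "P_plus_Q_orbit (adelic_pair_of_integral y) = P_plus_Q_orbit x"
proof -
  obtain a b \<alpha> where x: "x = (parabolic_matrix a b, \<alpha>)"
    using assms unfolding P_bar_def by auto
  obtain u m where m: "0 < m" "a = adele_frac u m" by (rule adele_frac_cases)
  obtain v n where n: "0 < n" "b = adele_frac v n" by (rule adele_frac_cases)
  define g :: "rat^2^2" where "g = parabolic_matrix (of_nat (m * n)) 0"
  have g: "g \<in> P_plus" using m n unfolding g_def P_plus_iff by (auto simp: parabolic_matrix_eq_iff)
  have mn: "adele_of_rat (of_nat (m * n)) = adele_frac (of_nat (m * n)) 1"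
    using adele_of_rat_of_int[of "int (m * n)"] by (simp add: adele_of_zhat_def)
  have "adele_of_rat (of_nat (m * n)) * a = adele_of_zhat (of_nat n * u)"
    "adele_of_rat (of_nat (m * n)) * b = adele_of_zhat (of_nat m * v)"
    unfolding mn m(2) n(2) adele_of_zhat_def using m(1) n(1)
    by (simp_all add: adele_frac_mult adele_frac_eq_iff algebra_simps)
  then have eq: "P_plus_Q_act g x
      = adelic_pair_of_integral (parabolic_matrix (of_nat n * u) (of_nat m * v), map_matrix of_rat g ** \<alpha>)"
    unfolding x P_plus_Q_act_def adelic_pair_of_integral_def g_def
    by (simp add: map_matrix_parabolic parabolic_matrix_mult)
  show ?thesis
  proof
    show "P_plus_Q_orbit (adelic_pair_of_integral
        (parabolic_matrix (of_nat n * u) (of_nat m * v), map_matrix of_rat g ** \<alpha>)) = P_plus_Q_orbit x"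
      unfolding eq[symmetric] using P_plus_Q_orbit_eq_iff g by blast
    show "(parabolic_matrix (of_nat n * u) (of_nat m * v), map_matrix of_rat g ** \<alpha>) \<in> P_bar \<times> P_plus"
      using P_plus_Q_act_closed[OF g assms] unfolding x P_plus_Q_act_def P_bar_def by auto
  qed
qed

section \<open>The identification of the two quotients\<close>

text \<open>
  A composition of open maps, surjective because every orbit has an integral representative.
\<close>

lemma quotient_map_integral_pairs:
  "quotient_map (top_of_set (P_bar \<times> P_plus)) adelic_quotient (P_plus_Q_orbit \<circ> adelic_pair_of_integral)"
proof (rule continuous_open_imp_quotient_map)
  let ?X = "top_of_set (P_bar \<times> P_plus :: ((zhat^2^2) \<times> (real^2^2)) set)"
  let ?Y = "top_of_set (P_bar \<times> P_plus :: adelic_pair set)"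
  have q: "quotient_map ?Y adelic_quotient P_plus_Q_orbit"
    unfolding adelic_quotient_def by (rule quotient_map_quotient_topology)
  have image: "adelic_pair_of_integral \<in> P_bar \<times> P_plus \<rightarrow> P_bar \<times> P_plus"
    by (auto simp: adelic_pair_of_integral_def P_bar_map_adele_of_zhat_iff)
  have F: "continuous_map ?X ?Y adelic_pair_of_integral"
    using image by (simp add: continuous_on_adelic_pair_of_integral)
  show "continuous_map ?X adelic_quotient (P_plus_Q_orbit \<circ> adelic_pair_of_integral)"
    by (rule continuous_map_compose[OF F quotient_imp_continuous_map[OF q]])
  show "open_map ?X adelic_quotient (P_plus_Q_orbit \<circ> adelic_pair_of_integral)"
    by (rule open_map_compose[OF open_map_adelic_pair_of_integral open_map_P_plus_Q_orbit])
  show "(P_plus_Q_orbit \<circ> adelic_pair_of_integral) ` topspace ?X = topspace adelic_quotient"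
  proof
    show "(P_plus_Q_orbit \<circ> adelic_pair_of_integral) ` topspace ?X \<subseteq> topspace adelic_quotient"
      using continuous_map_image_subset_topspace[OF continuous_map_compose[OF F quotient_imp_continuous_map[OF q]]] .
    have "P_plus_Q_orbit x \<in> (P_plus_Q_orbit \<circ> adelic_pair_of_integral) ` (P_bar \<times> P_plus)"
      if x: "x \<in> P_bar \<times> P_plus" for x
    proof -
      obtain y where "y \<in> P_bar \<times> P_plus" "P_plus_Q_orbit (adelic_pair_of_integral y) = P_plus_Q_orbit x"
        using integral_representative[OF x] .
      then show ?thesis by (intro image_eqI[of _ _ y]) simp_all
    qed
    then show "topspace adelic_quotient \<subseteq> (P_plus_Q_orbit \<circ> adelic_pair_of_integral) ` topspace ?X"
      by (auto simp: adelic_quotient_def topspace_quotient_topology)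
  qed
qed

lemma quotient_map_commensurability_class:
  "quotient_map (top_of_set (P_bar \<times> P_plus)) commensurability_space
    (commensurability_class \<circ> (\<lambda>(\<rho>, \<alpha>). Q_lattice_of \<rho> \<alpha>))"
  unfolding commensurability_space_def parabolic_topology_def
  by (rule quotient_map_compose[OF quotient_map_quotient_topology quotient_map_quotient_topology])

lemma commensurable_iff_orbit_eq:
  assumes "\<rho>1 \<in> P_bar" "\<rho>2 \<in> P_bar" "\<alpha>1 \<in> P_plus" "\<alpha>2 \<in> P_plus"
  shows "commensurable (Q_lattice_of \<rho>1 \<alpha>1) (Q_lattice_of \<rho>2 \<alpha>2) \<longleftrightarrow>
    P_plus_Q_orbit (adelic_pair_of_integral (\<rho>1, \<alpha>1)) = P_plus_Q_orbit (adelic_pair_of_integral (\<rho>2, \<alpha>2))"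
  unfolding parabolic_commensurable_iff[OF assms] P_plus_Q_orbit_eq_iff
  by (simp add: P_plus_Q_act_def adelic_pair_of_integral_def)

text \<open>
  Classes are compared through orbits, so that commensurability inherits reflexivity, symmetry and
  transitivity on parabolic lattices from the group action.
\<close>

lemma commensurability_class_eq_iff:
  assumes "\<rho>1 \<in> P_bar" "\<rho>2 \<in> P_bar" "\<alpha>1 \<in> P_plus" "\<alpha>2 \<in> P_plus"
  shows "commensurability_class (Q_lattice_of \<rho>1 \<alpha>1) = commensurability_class (Q_lattice_of \<rho>2 \<alpha>2) \<longleftrightarrow>
    P_plus_Q_orbit (adelic_pair_of_integral (\<rho>1, \<alpha>1)) = P_plus_Q_orbit (adelic_pair_of_integral (\<rho>2, \<alpha>2))"
proof
  have "Q_lattice_of \<rho>2 \<alpha>2 \<in> commensurability_class (Q_lattice_of \<rho>2 \<alpha>2)"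
    unfolding commensurability_class_def parabolic_Q_lattices_def
    using assms commensurable_iff_orbit_eq[OF assms(2,2,4,4)]
      Q_lattice_Q_lattice_of[OF invertible_P_plus[OF assms(4)]] by blast
  moreover assume "commensurability_class (Q_lattice_of \<rho>1 \<alpha>1) = commensurability_class (Q_lattice_of \<rho>2 \<alpha>2)"
  ultimately show "P_plus_Q_orbit (adelic_pair_of_integral (\<rho>1, \<alpha>1))
      = P_plus_Q_orbit (adelic_pair_of_integral (\<rho>2, \<alpha>2))"
    unfolding commensurable_iff_orbit_eq[OF assms, symmetric] unfolding commensurability_class_def by blast
next
  assume eq: "P_plus_Q_orbit (adelic_pair_of_integral (\<rho>1, \<alpha>1))
      = P_plus_Q_orbit (adelic_pair_of_integral (\<rho>2, \<alpha>2))"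
  have "commensurable (Q_lattice_of \<rho>1 \<alpha>1) Y \<longleftrightarrow> commensurable (Q_lattice_of \<rho>2 \<alpha>2) Y"
    if Y_parabolic: "Y \<in> parabolic_Q_lattices" for Y
  proof -
    obtain \<rho> \<alpha> where Y: "\<rho> \<in> P_bar" "\<alpha> \<in> P_plus" "Y = Q_lattice_of \<rho> \<alpha>"
      using Y_parabolic unfolding parabolic_Q_lattices_def by blast
    show ?thesis
      unfolding Y(3) commensurable_iff_orbit_eq[OF assms(1) Y(1) assms(3) Y(2)]
        commensurable_iff_orbit_eq[OF assms(2) Y(1) assms(4) Y(2)] eq ..
  qed
  then show "commensurability_class (Q_lattice_of \<rho>1 \<alpha>1) = commensurability_class (Q_lattice_of \<rho>2 \<alpha>2)"
    unfolding commensurability_class_def by blast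
qed

lemma homeomorphic_map_from_common_quotient:
  assumes f: "quotient_map X Y f" and k: "quotient_map X Z k"
    and fibres: "\<And>x y. x \<in> topspace X \<Longrightarrow> y \<in> topspace X \<Longrightarrow> f x = f y \<longleftrightarrow> k x = k y"
  obtains h where "homeomorphic_map Y Z h" "\<And>x. x \<in> topspace X \<Longrightarrow> h (f x) = k x"
proof -
  obtain h where h: "continuous_map Y Z h" "\<And>x. x \<in> topspace X \<Longrightarrow> h (f x) = k x"
    using quotient_map_lift_exists[OF f quotient_imp_continuous_map[OF k]] fibres by metis
  have "quotient_map X Z (h \<circ> f)"
    using quotient_map_eq[OF k] h(2) by simp
  then have "quotient_map Y Z h"
    using quotient_map_compose_eq[OF f] by blast
  moreover have "inj_on h (topspace Y)"
    unfolding quotient_imp_surjective_map[OF f, symmetric]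
    by (rule inj_onI) (use h(2) fibres in auto)
  ultimately show ?thesis using that h(2) by (simp add: homeomorphic_map_def)
qed

theorem theorem6p1:
  shows "(\<forall>\<rho>1\<in>(P_bar :: (zhat^2^2) set). \<forall>\<rho>2\<in>P_bar.
           \<forall>\<alpha>1\<in>(P_plus :: (real^2^2) set). \<forall>\<alpha>2\<in>P_plus.
      commensurable (Q_lattice_of \<rho>1 \<alpha>1) (Q_lattice_of \<rho>2 \<alpha>2) \<longleftrightarrow>
      (\<exists>g\<in>(P_plus :: (rat^2^2) set).
         map_matrix adele_of_zhat \<rho>2 = map_matrix adele_of_rat g ** map_matrix adele_of_zhat \<rho>1 \<and>
         \<alpha>2 = map_matrix of_rat g ** \<alpha>1))
    \<and> (\<exists>h. homeomorphic_map commensurability_space adelic_quotient h \<and>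
      (\<forall>\<rho>\<in>P_bar. \<forall>\<alpha>\<in>P_plus. h (commensurability_class (Q_lattice_of \<rho> \<alpha>)) =
         P_plus_Q_orbit (map_matrix adele_of_zhat \<rho>, \<alpha>)))"
proof (rule conjI)
  show "\<exists>h. homeomorphic_map commensurability_space adelic_quotient h \<and>
      (\<forall>\<rho>\<in>P_bar. \<forall>\<alpha>\<in>P_plus. h (commensurability_class (Q_lattice_of \<rho> \<alpha>)) =
         P_plus_Q_orbit (map_matrix adele_of_zhat \<rho>, \<alpha>))"
  proof -
    let ?X = "top_of_set (P_bar \<times> P_plus :: ((zhat^2^2) \<times> (real^2^2)) set)"
    let ?c = "commensurability_class \<circ> (\<lambda>(\<rho>, \<alpha>). Q_lattice_of \<rho> \<alpha>)"
    let ?o = "P_plus_Q_orbit \<circ> adelic_pair_of_integral"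
    have fibres: "?c x = ?c y \<longleftrightarrow> ?o x = ?o y" if "x \<in> topspace ?X" "y \<in> topspace ?X" for x y
      using that by (cases x; cases y) (simp add: commensurability_class_eq_iff)
    obtain h where h: "homeomorphic_map commensurability_space adelic_quotient h"
      "\<And>x. x \<in> topspace ?X \<Longrightarrow> h (?c x) = ?o x"
      by (rule homeomorphic_map_from_common_quotient[OF quotient_map_commensurability_class
            quotient_map_integral_pairs fibres]) auto
    have "h (commensurability_class (Q_lattice_of \<rho> \<alpha>)) = P_plus_Q_orbit (map_matrix adele_of_zhat \<rho>, \<alpha>)"
      if "\<rho> \<in> P_bar" "\<alpha> \<in> P_plus" for \<rho> \<alpha>
      using h(2)[of "(\<rho>, \<alpha>)"] that by (simp add: adelic_pair_of_integral_def)
    with h(1) show ?thesis by blast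
  qed
qed (intro ballI parabolic_commensurable_iff)

end
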